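(* Let $d=3$ and $W(\mathbf{x})=\frac{|\mathbf{x}|^3}{3}+|\mathbf{x}|^{-1}$ on $\mathbb{R}^3$ (with $W(0)=+\infty$), and let $\beta=2^{1/4}$. There is a unique positive number $R$ satisfying $$\cos(2\beta R)+\cosh(2\beta R)+\beta R\sin(2\beta R)-\beta R\sinh(2\beta R)=0,$$ and the unique minimizer (up to translation) of the interaction energy $E$ over probability measures on $\mathbb{R}^3$ is the measure with density, writing $r=|\mathbf{x}|$, $$\rho_3(\mathbf{x})=\frac{C}{r}\Big[\big(\cosh(\beta r)\sin(\beta r)+\sinh(\beta r)\cos(\beta r)\big)+\tan(\beta R)\tanh(\beta R)\big(\cosh(\beta r)\sin(\beta r)-\sinh(\beta r)\cos(\beta r)\big)\Big]\chi_{r\le R},$$ where $C$ is the normalizing constant making the total mass equal to $1$.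
   Context: For a probability measure $\rho$ on $\mathbb{R}^3$, the interaction energy is $E[\rho]=\frac12\int_{\mathbb{R}^3}\int_{\mathbb{R}^3}W(\mathbf{x}-\mathbf{y})\,d\rho(\mathbf{y})\,d\rho(\mathbf{x})\in\mathbb{R}\cup\{+\infty\}$. $\chi$ denotes an indicator function. *)

theory Defs
  imports "HOL-Probability.Probability"
begin

(* The potential takes the value +\<infinity> at the origin and is nonnegative, so it is valued in
   ennreal; the energy is then a nonnegative Lebesgue integral and may be infinite. *)
definition W :: "real^3 \<Rightarrow> ennreal" where
  "W x = (if x = 0 then \<infinity> else ennreal (norm x ^ 3 / 3 + 1 / norm x))"

definition borel_prob :: "(real^3) measure \<Rightarrow> bool" where
  "borel_prob \<rho> \<longleftrightarrow> prob_space \<rho> \<and> sets \<rho> = sets borel"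

definition energy :: "(real^3) measure \<Rightarrow> ennreal" where
  "energy \<rho> = (1 / 2) * (\<integral>\<^sup>+ x. (\<integral>\<^sup>+ y. W (x - y) \<partial>\<rho>) \<partial>\<rho>)"

definition is_minimizer :: "(real^3) measure \<Rightarrow> bool" where
  "is_minimizer \<rho> \<longleftrightarrow> borel_prob \<rho> \<and> (\<forall>\<nu>. borel_prob \<nu> \<longrightarrow> energy \<rho> \<le> energy \<nu>)"

definition translate :: "real^3 \<Rightarrow> (real^3) measure \<Rightarrow> (real^3) measure" where
  "translate a \<rho> = distr \<rho> borel (\<lambda>x. x + a)"

definition \<beta> :: real where
  "\<beta> = 2 powr (1 / 4)"

definition radius_eq :: "real \<Rightarrow> bool" where
  "radius_eq R \<longleftrightarrow>
     cos (2 * \<beta> * R) + cosh (2 * \<beta> * R) + \<beta> * R * sin (2 * \<beta> * R) - \<beta> * R * sinh (2 * \<beta> * R) = 0"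

(* At x = 0 the quotient is 0 by convention; this affects only a null set. *)
definition rho3 :: "real \<Rightarrow> real \<Rightarrow> real^3 \<Rightarrow> real" where
  "rho3 R C x = (let r = norm x in
     C / r *
     ((cosh (\<beta> * r) * sin (\<beta> * r) + sinh (\<beta> * r) * cos (\<beta> * r))
      + tan (\<beta> * R) * tanh (\<beta> * R) *
        (cosh (\<beta> * r) * sin (\<beta> * r) - sinh (\<beta> * r) * cos (\<beta> * r)))
     * indicator {s. s \<le> R} r)"

end

(* W * rho is constant on the support of the proposed density rho and larger outside, so
   interaction(rho, nu) >= interaction(rho, rho) for every nu without an atom at 0. On the other hand
   W(x) is an integral over t > 0 of a exp(-t^2|x|^2) + b t^-4 (exp(-t^2|x|^2) - 1 + t^2|x|^2); between
   measures of the same mass and centre the last two terms cancel by polarization, and Gaussians are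
   positive definite. Hence interaction(rho, rho) + interaction(nu, nu) = 2 interaction(rho, nu) + D
   with D >= 0, and D = 0 forces the mollifications of rho and nu to agree for almost every t, so that
   nu = rho. All quantities are nonnegative, so no integrability question arises.

   For the potential, r (W * rho)(r) is a one-dimensional convolution of the odd function u(s) = s rho(s)
   with |q|^5/15 + |q|, and u^(4) = -8 u makes all integrals elementary. Outside the ball the
   potential exceeds its inner value because the difference is a positive combination of
   (r - R)^3 (r + 3R) and (r - R)^2. *)
theory Submission
  imports Defs "HOL-Real_Asymp.Real_Asymp"
begin

section \<open>The radius and the radial profile\<close>

text \<open>The double Laplacian of |x|^3/3 is 8/|x|, and the Laplacian of 1/|x| is -4 pi times the
  Dirac mass at 0. Three Laplacians therefore turn constancy of W * rho on the ball into the local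
  equation Laplacian^2 rho = -8 rho. For u(r) = r rho(r) it reads u'''' = -8 u = -4 beta^4 u. This
  explains beta = 2^(1/4) and the products of cosh, sinh with sin, cos; regularity at 0 keeps the
  two odd ones.

  Conversely, for such u the function r (W * rho)(r) is a polynomial on [0, R] whose coefficients
  are read off at R. Killing r^5 gives u'''(R) = 0, which fixes the weight tan(beta R) tanh(beta R);
  killing r^3 then gives u'(R) = R u''(R), which fixes R.

  Polarization needs second moments and equal means, so a competitor must be shown to have a second
  moment before it can be centred. Finite interaction provides this through the cubic growth of W.
  Subtraction is truncated in the extended nonnegative reals, so identities are arranged as
  equalities of sums and only finite terms are cancelled.\<close>

lemma beta_pos: "\<beta> > 0" by (simp add: \<beta>_def)

lemma beta_pow4: "\<beta> ^ 4 = 2"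
proof -
  have "\<beta> ^ 4 = \<beta> powr 4" using beta_pos powr_numeral[of \<beta> "num.Bit0 (num.Bit0 num.One)"] by simp
  then show ?thesis by (simp add: \<beta>_def powr_powr)
qed

text \<open>Positivity is asked only for x > 0 because the derivatives it is applied to vanish at
  0.\<close>

lemma less_if_deriv_pos:
  fixes f :: "real \<Rightarrow> real"
  assumes "\<And>x. x \<ge> 0 \<Longrightarrow> (f has_real_derivative f' x) (at x)"
    and "\<And>x. x > 0 \<Longrightarrow> f' x > 0" and "0 \<le> a" "a < b"
  shows "f a < f b"
proof (rule DERIV_pos_imp_increasing_open[OF \<open>a < b\<close>])
  fix x assume "a < x" "x < b"
  then show "\<exists>y. DERIV f x :> y \<and> y > 0"
    using assms(1)[of x] assms(2)[of x] \<open>0 \<le> a\<close> by auto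
next
  show "continuous_on {a..b} f"
    using assms(1) \<open>0 \<le> a\<close>
    by (meson DERIV_isCont atLeastAtMost_iff continuous_at_imp_continuous_on order_trans)
qed

text \<open>The radius equation in the variable w = 2 \<beta> R, with the sign reversed so that the
  function increases.\<close>

definition radius_fun :: "real \<Rightarrow> real" where
  "radius_fun w = w * (sinh w - sin w) / 2 - cosh w - cos w"

lemma radius_eq_iff: "radius_eq R \<longleftrightarrow> radius_fun (2 * \<beta> * R) = 0"
  unfolding radius_eq_def radius_fun_def by (auto simp: algebra_simps)

lemma radius_fun_deriv:
  "(radius_fun has_real_derivative (w * (cosh w - cos w) - (sinh w - sin w)) / 2) (at w)"
  unfolding radius_fun_def[abs_def]
  by (auto intro!: derivative_eq_intros simp: field_simps)

text \<open>The numerator of the derivative vanishes at 0 and has itself the derivative x (sinh x +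
  sin x), so two applications of the monotonicity criterion reduce everything to the sign of sinh +
  sin.\<close>

lemma radius_fun_strict_mono:
  assumes "0 \<le> a" "a < b" shows "radius_fun a < radius_fun b"
proof (rule less_if_deriv_pos[OF radius_fun_deriv _ assms])
  fix x :: real assume x: "x > 0"
  have "0 * (cosh 0 - cos 0) - (sinh 0 - sin 0) < x * (cosh x - cos x) - (sinh x - sin x)"
  proof (rule less_if_deriv_pos[where f = "\<lambda>x::real. x * (cosh x - cos x) - (sinh x - sin x)"
        and f' = "\<lambda>x. x * (sinh x + sin x)"])
    fix y :: real assume y: "y > 0"
    \<comment> \<open>Below pi both terms are positive; beyond it sinh y \<ge> y > 1 outweighs the
      sine.\<close>
    have "sinh y + sin y > 0"
    proof (cases "y < pi")
      case True
      then show ?thesis using y sin_gt_zero[of y] by (simp add: add_pos_pos)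
    next
      case False
      then have "y > 1" using pi_gt3 by linarith
      have "sinh y \<ge> y"
        using less_if_deriv_pos[where f = "\<lambda>x::real. sinh x - x" and f' = "\<lambda>x. cosh x - 1" and a = 0 and b = y]
              cosh_real_strict_mono[of 0] y
        by (force intro!: derivative_eq_intros)
      then show ?thesis using \<open>y > 1\<close> sin_ge_minus_one[of y] by linarith
    qed
    then show "0 < y * (sinh y + sin y)" using y by simp
  qed (use x in \<open>auto intro!: derivative_eq_intros simp: algebra_simps\<close>)
  then show "0 < (x * (cosh x - cos x) - (sinh x - sin x)) / 2" by simp
qed

text \<open>This confines the root to w < pi. It serves twice: as the upper end for the intermediate
  value theorem, and to keep \<beta> R below pi / 2.\<close>

lemma radius_fun_pi_pos: "radius_fun pi > 0"
proof -
  have "cosh pi - 1 < sinh (pi::real)"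
    using cosh_minus_sinh[of pi] by (smt (verit) exp_less_one_iff pi_gt_zero)
  moreover have "sinh pi * 1 \<le> sinh pi * (pi / 2)"
    using pi_gt3 by (intro mult_left_mono) auto
  ultimately have "cosh pi - 1 < sinh pi * (pi / 2)" by linarith
  then show ?thesis by (simp add: radius_fun_def mult.commute)
qed

lemma ex1_radius: "\<exists>!R. R > 0 \<and> radius_eq R"
proof -
  have "\<exists>w\<ge>0. w \<le> pi \<and> radius_fun w = 0"
    using IVT[of radius_fun 0 0 pi] radius_fun_pi_pos radius_fun_deriv DERIV_isCont
    by (force simp: radius_fun_def)
  then obtain w where w: "0 \<le> w" "radius_fun w = 0" by blast
  have "w \<noteq> 0" using w(2) by (auto simp: radius_fun_def)
  show ?thesis
  proof (intro ex1I[of _ "w / (2 * \<beta>)"] conjI)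
    show "w / (2 * \<beta>) > 0" using w \<open>w \<noteq> 0\<close> beta_pos by simp
    show "radius_eq (w / (2 * \<beta>))" using w beta_pos by (simp add: radius_eq_iff)
  next
    fix R assume R: "R > 0 \<and> radius_eq R"
    then have "radius_fun (2 * \<beta> * R) = 0" "2 * \<beta> * R \<ge> 0" using beta_pos by (auto simp: radius_eq_iff)
    then have "2 * \<beta> * R = w"
      using w radius_fun_strict_mono[of w "2 * \<beta> * R"] radius_fun_strict_mono[of "2 * \<beta> * R" w]
      by (metis less_irrefl linorder_less_linear)
    then show "R = w / (2 * \<beta>)" using beta_pos by (auto simp: field_simps)
  qed
qed

text \<open>On the whole ball the angle \<beta> r stays in the first quadrant, so the tangent is
  positive and the density does not change sign.\<close>

lemma radius_less:
  assumes "R > 0" "radius_eq R" shows "\<beta> * R < pi / 2"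
proof (rule ccontr)
  assume "\<not> ?thesis"
  then have "pi \<le> 2 * \<beta> * R" by simp
  then have "radius_fun pi \<le> radius_fun (2 * \<beta> * R)"
    using radius_fun_strict_mono[of pi "2 * \<beta> * R"] by (cases "pi = 2 * \<beta> * R") auto
  then show False using assms radius_fun_pi_pos by (simp add: radius_eq_iff)
qed

section \<open>Odd solutions of u'''' = -8 u and their values at the radius\<close>

text \<open>With \<open>k = tan (\<beta> R) tanh (\<beta> R)\<close>, \<open>U0 k\<close> is \<open>r \<rho>\<^sub>3(r)\<close> up to the factor \<open>C\<close>, and \<open>U1\<close>, \<open>U2\<close>,
  \<open>U3\<close> are its derivatives. The choice of \<open>k\<close> makes \<open>U3\<close> vanish at \<open>R\<close>; the equation for \<open>R\<close> is
  then equivalent to \<open>U1 = R U2\<close> at \<open>R\<close>.\<close>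

definition U0 :: "real \<Rightarrow> real \<Rightarrow> real" where
  "U0 k r = (cosh (\<beta> * r) * sin (\<beta> * r) + sinh (\<beta> * r) * cos (\<beta> * r))
      + k * (cosh (\<beta> * r) * sin (\<beta> * r) - sinh (\<beta> * r) * cos (\<beta> * r))"
definition U1 :: "real \<Rightarrow> real \<Rightarrow> real" where
  "U1 k r = 2 * \<beta> * (cosh (\<beta> * r) * cos (\<beta> * r) + k * (sinh (\<beta> * r) * sin (\<beta> * r)))"
definition U2 :: "real \<Rightarrow> real \<Rightarrow> real" where
  "U2 k r = 2 * \<beta>^2 * (k * (cosh (\<beta> * r) * sin (\<beta> * r) + sinh (\<beta> * r) * cos (\<beta> * r))
      - (cosh (\<beta> * r) * sin (\<beta> * r) - sinh (\<beta> * r) * cos (\<beta> * r)))"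
definition U3 :: "real \<Rightarrow> real \<Rightarrow> real" where
  "U3 k r = 4 * \<beta>^3 * (k * (cosh (\<beta> * r) * cos (\<beta> * r)) - sinh (\<beta> * r) * sin (\<beta> * r))"

lemma U0_deriv: "(U0 k has_real_derivative U1 k r) (at r)"
  unfolding U0_def[abs_def] U1_def
  by (auto intro!: derivative_eq_intros simp: algebra_simps)
lemma U1_deriv: "(U1 k has_real_derivative U2 k r) (at r)"
  unfolding U1_def[abs_def] U2_def
  by (auto intro!: derivative_eq_intros simp: algebra_simps power2_eq_square)
lemma U2_deriv: "(U2 k has_real_derivative U3 k r) (at r)"
  unfolding U2_def[abs_def] U3_def
  by (auto intro!: derivative_eq_intros simp: algebra_simps power2_eq_square power3_eq_cube)
lemma U3_deriv: "(U3 k has_real_derivative - 8 * U0 k r) (at r)"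
proof -
  have "(U3 k has_real_derivative - 4 * \<beta>^4 * U0 k r) (at r)"
    unfolding U3_def[abs_def] U0_def
    by (auto intro!: derivative_eq_intros simp: algebra_simps power3_eq_cube power4_eq_xxxx)
  then show ?thesis by (simp add: beta_pow4)
qed

lemma U_at_0 [simp]: "U0 k 0 = 0" "U2 k 0 = 0"
  by (simp_all add: U0_def U2_def)

text \<open>In the first quadrant the first bracket is a sum of nonnegative products. The second
  vanishes at 0 and has derivative 2 sinh sin, which is nonnegative there.\<close>

lemma U0_nonneg:
  assumes "0 \<le> k" "0 \<le> r" "\<beta> * r \<le> pi / 2"
  shows "U0 k r \<ge> 0"
proof -
  define z where "z = \<beta> * r"
  have z: "0 \<le> z" "z \<le> pi / 2" using assms beta_pos by (auto simp: z_def)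
  have "sin z \<ge> 0" "cos z \<ge> 0" using z by (auto intro: sin_ge_zero cos_ge_zero)
  moreover have "cosh 0 * sin 0 - sinh 0 * cos 0 \<le> cosh z * sin z - sinh z * cos z"
  proof (rule DERIV_nonneg_imp_nondecreasing[OF z(1)])
    fix x :: real assume x: "0 \<le> x" "x \<le> z"
    have "((\<lambda>z. cosh z * sin z - sinh z * cos z) has_real_derivative 2 * (sinh x * sin x)) (at x)"
      by (auto intro!: derivative_eq_intros simp: algebra_simps)
    moreover have "sin x \<ge> 0" using x z by (intro sin_ge_zero) auto
    ultimately show "\<exists>y. ((\<lambda>z. cosh z * sin z - sinh z * cos z) has_real_derivative y) (at x) \<and> 0 \<le> y"
      using x by (force intro!: exI)
  qed
  ultimately show ?thesis using assms z unfolding U0_def z_def[symmetric] by simp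
qed

lemma boundary_conditions:
  assumes R: "R > 0" "radius_eq R"
  defines "k \<equiv> tan (\<beta> * R) * tanh (\<beta> * R)"
  shows "cos (\<beta> * R) > 0" "k \<ge> 0" "U3 k R = 0" "U1 k R = R * U2 k R" "U2 k R > 0"
proof -
  define z where "z = \<beta> * R"
  have z: "0 < z" "z < pi / 2" using radius_less[OF R] beta_pos R by (auto simp: z_def)
  have c: "cos z > 0" and s: "sin z > 0" using z by (auto intro: cos_gt_zero sin_gt_zero)
  have t: "sinh z > 0" "cosh z > 0" using z by auto
  show "cos (\<beta> * R) > 0" using c by (simp add: z_def)
  show k0: "k \<ge> 0"
    using c s t unfolding k_def z_def[symmetric] by (simp add: tan_def tanh_def)
  have k: "k * (cosh z * cos z) = sinh z * sin z"
    using c t unfolding k_def z_def[symmetric] by (simp add: tan_def tanh_def)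
  show "U3 k R = 0" using k unfolding U3_def z_def[symmetric] by simp
  have id1: "cos (2 * z) + cosh (2 * z) = 2 * ((cosh z * cos z)^2 + (sinh z * sin z)^2)"
  proof -
    have *: "(cos z)^2 = 1 - (sin z)^2" "(cosh z)^2 = 1 + (sinh z)^2"
      by (auto simp: cos_squared_eq cosh_square_eq)
    show ?thesis
      unfolding cos_double cosh_double power_mult_distrib * by (simp add: algebra_simps)
  qed
  \<comment> \<open>Half of the radius equation, rewritten with double angle formulas in terms of z
    = \<beta> R.\<close>
  have e: "z * (sinh z * cosh z - sin z * cos z) = (cosh z * cos z)^2 + (sinh z * sin z)^2"
    using R(2) id1 unfolding radius_eq_def mult.assoc z_def[symmetric] sin_double sinh_double
    by (simp add: algebra_simps)
  \<comment> \<open>Multiplying by \<open>cosh z * cos z\<close> allows k to be eliminated through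
    \<open>k\<close>; what remains is the left side of \<open>e\<close>.\<close>
  have "z * (k * (cosh z * sin z + sinh z * cos z) - (cosh z * sin z - sinh z * cos z)) * (cosh z * cos z)
     = z * (sinh z * sin z * (cosh z * sin z + sinh z * cos z) - (cosh z * sin z - sinh z * cos z) * (cosh z * cos z))"
    unfolding k[symmetric] by (simp add: algebra_simps)
  also have "\<dots> = z * (sinh z * cosh z * ((sin z)^2 + (cos z)^2) - sin z * cos z * ((cosh z)^2 - (sinh z)^2))"
    by algebra
  also have "\<dots> = z * (sinh z * cosh z - sin z * cos z)"
    unfolding sin_cos_squared_add by (simp add: cosh_square_eq)
  also have "\<dots> = (cosh z * cos z + k * (sinh z * sin z)) * (cosh z * cos z)"
    unfolding e using k by (simp add: algebra_simps power2_eq_square)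
  finally have main: "z * (k * (cosh z * sin z + sinh z * cos z) - (cosh z * sin z - sinh z * cos z))
      = cosh z * cos z + k * (sinh z * sin z)"
    using c t by simp
  have "\<beta> * U1 k R = \<beta> * (R * U2 k R)"
    unfolding U1_def U2_def z_def[symmetric] main[symmetric] by (simp add: z_def power2_eq_square)
  then show U12: "U1 k R = R * U2 k R" using beta_pos by simp
  \<comment> \<open>The sign of \<open>U2\<close> is not visible from its formula, but
    \<open>U1\<close> is a sum of products of positive quantities and equals R times
    \<open>U2\<close> at R.\<close>
  have "U1 k R > 0" unfolding U1_def z_def[symmetric]
    using beta_pos c s t k0 by (intro mult_pos_pos add_pos_nonneg mult_nonneg_nonneg) auto
  then show "U2 k R > 0" unfolding U12 using R(1) by (simp add: zero_less_mult_iff)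
qed

section \<open>The one-dimensional potential of a radial profile\<close>

text \<open>An antiderivative of \<open>q \<mapsto> q (q^3 / 3 + 1 / q)\<close>.\<close>

definition kernel1 :: "real \<Rightarrow> real" where "kernel1 q = q^5 / 15 + q"

lemma kernel1_mono: "a \<le> b \<Longrightarrow> kernel1 a \<le> kernel1 b"
  unfolding kernel1_def by (intro add_mono divide_right_mono power_mono_odd) auto

lemma kernel1_measurable [measurable]: "kernel1 \<in> borel_measurable borel"
  unfolding kernel1_def[abs_def] by measurable

text \<open>Only the differential equation, the boundary values and the sign enter the computation
  of the potential, so the normalizing constant can be absorbed into u later. The first two
  conditions at R remove the r^5 and r^3 terms of the potential; \<open>u2 R\<close> is up to a
  factor the total mass.\<close>

locale radial_profile =
  fixes u u1 u2 u3 :: "real \<Rightarrow> real" and R :: real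
  assumes deriv: "\<And>s. (u has_real_derivative u1 s) (at s)" "\<And>s. (u1 has_real_derivative u2 s) (at s)"
      "\<And>s. (u2 has_real_derivative u3 s) (at s)" "\<And>s. (u3 has_real_derivative - 8 * u s) (at s)"
    and at_0: "u 0 = 0" "u2 0 = 0"
    and at_R: "u3 R = 0" "u1 R = R * u2 R" "u2 R \<ge> 0"
    and R_pos: "R > 0"
    and nonneg: "\<And>s. 0 \<le> s \<Longrightarrow> s \<le> R \<Longrightarrow> u s \<ge> 0"
begin

lemma isCont: "isCont u s" using deriv(1) by (rule DERIV_isCont)

lemma measurable [measurable]: "u \<in> borel_measurable borel"
  by (intro borel_measurable_continuous_onI continuous_at_imp_continuous_on ballI isCont)

text \<open>Since the fourth derivative of \<open>u\<close> is \<open>- 8 u\<close>, repeated integration by parts expresses antiderivatives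
  of \<open>u\<close> times a polynomial through \<open>u, u1, u2, u3\<close> with polynomial coefficients.\<close>

definition near :: "real \<Rightarrow> real \<Rightarrow> real" where
  "near r s = (2 + 2 * r^4 / 3) * (u2 s / 8 - s * u3 s / 8)
    + 4 * r^2 / 3 * (6 * u s / 8 - 6 * s * u1 s / 8 + 3 * s^2 * u2 s / 8 - s^3 * u3 s / 8)
    + 2 / 15 * (- 120 * u2 s / 64 + 120 * s * u3 s / 64 + 60 * s^2 * u s / 8 - 20 * s^3 * u1 s / 8
        + 5 * s^4 * u2 s / 8 - s^5 * u3 s / 8)"

definition far :: "real \<Rightarrow> real \<Rightarrow> real" where
  "far r s = (2 * r + 2 * r^5 / 15) * (- u3 s / 8)
    + 4 * r^3 / 3 * (- 2 * u1 s / 8 + 2 * s * u2 s / 8 - s^2 * u3 s / 8)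
    + 2 * r / 3 * (24 * u3 s / 64 + 24 * s * u s / 8 - 12 * s^2 * u1 s / 8 + 4 * s^3 * u2 s / 8 - s^4 * u3 s / 8)"

lemma near_deriv: "(near r has_real_derivative u s * (kernel1 (s + r) - kernel1 (r - s))) (at s)"
  unfolding near_def[abs_def] kernel1_def
  by (auto intro!: derivative_eq_intros deriv) (simp add: field_simps eval_nat_numeral)

lemma far_deriv: "(far r has_real_derivative u s * (kernel1 (s + r) - kernel1 (s - r))) (at s)"
  unfolding far_def[abs_def] kernel1_def
  by (auto intro!: derivative_eq_intros deriv) (simp add: field_simps eval_nat_numeral)

lemma near_0 [simp]: "near r 0 = 0" by (simp add: near_def at_0)
text \<open>This is where the factor 8 matters. At s = r the two antiderivatives differ by (2/8 -
  16/64) u2 r, which is 0 for this factor. Hence the integrals over [0, r] and [r, R] fit together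
  and only the boundary value at R survives.\<close>

lemma near_far: "near r r = far r r"
  unfolding near_def far_def by (simp add: field_simps eval_nat_numeral)
text \<open>Linearity in r is exactly constancy of the potential in the ball, since the potential is
  this value divided by r up to a constant factor.\<close>

lemma far_R: "far r R = r * (2 / 3 * (3 * R * u R - R^3 * u2 R))"
  unfolding far_def at_R by (simp add: field_simps eval_nat_numeral)
lemma near_R: "near r R = r * (2 / 3 * (3 * R * u R - R^3 * u2 R))
   + (2 / 3 * u2 R * (r - R)^3 * (r + 3 * R) + 8 * u R * (r - R)^2) / 8"
  unfolding near_def at_R by (simp add: field_simps eval_nat_numeral)

text \<open>The constant value of the potential on the ball, up to the factor 2 pi.\<close>

definition lam :: real where "lam = 2 / 3 * (3 * R * u R - R^3 * u2 R)"

lemma nn_integral_profile_inside: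
  assumes "0 < r" "r \<le> R"
  shows "(\<integral>\<^sup>+s. ennreal (u s * (kernel1 (s + r) - kernel1 \<bar>r - s\<bar>)) * indicator {0..R} s \<partial>lborel) = ennreal (r * lam)"
    and "0 \<le> r * lam"
proof -
  have n: "(\<integral>\<^sup>+s. ennreal (u s * (kernel1 (s + r) - kernel1 (r - s))) * indicator {0..r} s \<partial>lborel) = ennreal (near r r - near r 0)"
    using assms by (intro nn_integral_FTC_Icc[where F = "near r"] near_deriv mult_nonneg_nonneg nonneg)
        (auto intro!: kernel1_mono DERIV_subset[OF near_deriv])
  have f: "(\<integral>\<^sup>+s. ennreal (u s * (kernel1 (s + r) - kernel1 (s - r))) * indicator {r..R} s \<partial>lborel) = ennreal (far r R - far r r)"
    using assms by (intro nn_integral_FTC_Icc[where F = "far r"] far_deriv mult_nonneg_nonneg nonneg)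
        (auto intro!: kernel1_mono DERIV_subset[OF far_deriv])
  \<comment> \<open>Both increments must be nonnegative before their images under
    \<open>ennreal\<close> may be added, since \<open>ennreal\<close> sends negative numbers to
    0.\<close>
  have n0: "near r 0 \<le> near r r"
  proof (rule DERIV_nonneg_imp_nondecreasing[where f = "near r"])
    fix s assume s: "0 \<le> s" "s \<le> r"
    have "u s * (kernel1 (s + r) - kernel1 (r - s)) \<ge> 0"
      using s assms nonneg[of s] kernel1_mono[of "r - s" "s + r"] by simp
    then show "\<exists>y. (near r has_real_derivative y) (at s) \<and> 0 \<le> y" using near_deriv by blast
  qed (use assms in auto)
  have f0: "far r r \<le> far r R"
  proof (rule DERIV_nonneg_imp_nondecreasing[where f = "far r"])
    fix s assume s: "r \<le> s" "s \<le> R"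
    have "u s * (kernel1 (s + r) - kernel1 (s - r)) \<ge> 0"
      using s assms nonneg[of s] kernel1_mono[of "s - r" "s + r"] by simp
    then show "\<exists>y. (far r has_real_derivative y) (at s) \<and> 0 \<le> y" using far_deriv by blast
  qed (use assms in auto)
  have "(\<integral>\<^sup>+s. ennreal (u s * (kernel1 (s + r) - kernel1 \<bar>r - s\<bar>)) * indicator {0..R} s \<partial>lborel)
    = (\<integral>\<^sup>+s. ennreal (u s * (kernel1 (s + r) - kernel1 (r - s))) * indicator {0..r} s
       + ennreal (u s * (kernel1 (s + r) - kernel1 (s - r))) * indicator {r..R} s \<partial>lborel)"
  proof (rule nn_integral_cong_AE)
    show "AE s in lborel. ennreal (u s * (kernel1 (s + r) - kernel1 \<bar>r - s\<bar>)) * indicator {0..R} s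
      = ennreal (u s * (kernel1 (s + r) - kernel1 (r - s))) * indicator {0..r} s
       + ennreal (u s * (kernel1 (s + r) - kernel1 (s - r))) * indicator {r..R} s"
      using AE_lborel_singleton[of r]
      by eventually_elim (use assms in \<open>auto split: split_indicator simp: abs_if\<close>)
  qed
  also have "\<dots> = ennreal (near r r - near r 0) + ennreal (far r R - far r r)"
    using n f by (subst nn_integral_add) auto
  also have "\<dots> = ennreal (r * lam)"
    using n0 f0 by (subst ennreal_plus[symmetric]) (auto simp: near_far far_R lam_def)
  finally show "(\<integral>\<^sup>+s. ennreal (u s * (kernel1 (s + r) - kernel1 \<bar>r - s\<bar>)) * indicator {0..R} s \<partial>lborel) = ennreal (r * lam)" .
  show "0 \<le> r * lam" using n0 f0 by (simp add: near_far far_R lam_def)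
qed

lemma nn_integral_profile_outside:
  assumes "R < r"
  shows "(\<integral>\<^sup>+s. ennreal (u s * (kernel1 (s + r) - kernel1 \<bar>r - s\<bar>)) * indicator {0..R} s \<partial>lborel) \<ge> ennreal (r * lam)"
proof -
  have "(\<integral>\<^sup>+s. ennreal (u s * (kernel1 (s + r) - kernel1 \<bar>r - s\<bar>)) * indicator {0..R} s \<partial>lborel)
     = (\<integral>\<^sup>+s. ennreal (u s * (kernel1 (s + r) - kernel1 (r - s))) * indicator {0..R} s \<partial>lborel)"
    using assms by (intro nn_integral_cong) (auto split: split_indicator)
  also have "\<dots> = ennreal (near r R - near r 0)"
    using assms R_pos by (intro nn_integral_FTC_Icc[where F = "near r"] near_deriv mult_nonneg_nonneg nonneg)
        (auto intro!: kernel1_mono DERIV_subset[OF near_deriv])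
  also have "\<dots> \<ge> ennreal (r * lam)"
    using assms R_pos at_R nonneg[of R] unfolding near_R near_0 lam_def
    by (intro ennreal_leI) simp
  finally show ?thesis .
qed

lemma nn_integral_profile_mass:
  "(\<integral>\<^sup>+s. ennreal (u s * s) * indicator {0..R} s \<partial>lborel) = ennreal (u2 R / 8)"
proof -
  have "(\<integral>\<^sup>+s. ennreal (u s * s) * indicator {0..R} s \<partial>lborel) = ennreal ((u2 R / 8 - R * u3 R / 8) - (u2 0 / 8 - 0 * u3 0 / 8))"
    using R_pos nonneg
    by (intro nn_integral_FTC_Icc[where F = "\<lambda>s. u2 s / 8 - s * u3 s / 8"])
       (auto intro!: derivative_eq_intros deriv simp: field_simps)
  then show ?thesis by (simp add: at_R at_0)
qed

end

section \<open>Bipolar coordinates\<close>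

text \<open>The preimage of a box is its image under the inverse map, to which invariance of
  Lebesgue measure under orthogonal images applies.\<close>

lemma lborel_distr_orthogonal:
  fixes f :: "real^'n::{finite,wellorder} \<Rightarrow> real^'n::_"
  assumes f: "orthogonal_transformation f"
  shows "distr lborel borel f = lborel"
proof (rule lborel_eqI[symmetric])
  have lin: "linear f" using f by (simp add: orthogonal_transformation_linear)
  have cont: "continuous_on UNIV f" using lin by (simp add: linear_continuous_on linear_conv_bounded_linear)
  have fb [measurable]: "f \<in> borel_measurable borel" using cont by (rule borel_measurable_continuous_onI)
  fix l u :: "real^'n::{finite,wellorder}"
  assume lu: "\<And>b. b \<in> Basis \<Longrightarrow> l \<bullet> b \<le> u \<bullet> b"
  obtain g where g: "orthogonal_transformation g" "\<And>x. g (f x) = x" "\<And>x. f (g x) = x"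
    using f orthogonal_transformation_inv orthogonal_transformation_bij 
    by (metis bij_inv_eq_iff)
  have eq: "f -` box l u = g ` box l u" using g by (auto simp: image_iff) metis
  have lm: "box l u \<in> lmeasurable" by simp
  have "emeasure (distr lborel borel f) (box l u) = emeasure lborel (g ` box l u)"
    by (simp add: emeasure_distr eq)
  also have "\<dots> = emeasure lebesgue (g ` box l u)"
    using measurable_sets[OF fb, of "box l u"] by (simp add: eq)
  also have "\<dots> = emeasure lebesgue (box l u)"
    using measurable_orthogonal_image[OF g(1) lm] measure_orthogonal_image[OF g(1) lm] lm
    by (simp add: emeasure_eq_measure2 fmeasurableD2)
  also have "\<dots> = (\<Prod>b\<in>Basis. (u - l) \<bullet> b)"
    using lu by (simp add: emeasure_lborel_box_eq)
  finally show "emeasure (distr lborel borel f) (box l u) = (\<Prod>b\<in>Basis. (u - l) \<bullet> b)" .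
qed simp

text \<open>The nesting of pairs separates the plane orthogonal to the third axis from the height,
  so that product integration yields cylindrical coordinates.\<close>

definition vec3 :: "(real \<times> real) \<times> real \<Rightarrow> real^3" where
  "vec3 p = vector [fst (fst p), snd (fst p), snd p]"

lemma vec3_measurable [measurable]: "vec3 \<in> borel_measurable borel"
proof (subst borel_measurable_euclidean_space, intro ballI)
  fix b :: "real^3" assume "b \<in> Basis"
  then obtain i where b: "b = axis i 1" by (auto simp: Basis_vec_def)
  have "continuous_on UNIV (\<lambda>p. vec3 p $ i)"
    using exhaust_3[of i] by (elim disjE) (simp_all add: vec3_def continuous_intros)
  then show "(\<lambda>p. vec3 p \<bullet> b) \<in> borel_measurable borel"
    unfolding b inner_axis by (simp add: borel_measurable_continuous_onI)
qed

lemma prod_Basis_3: "(\<Prod>b\<in>Basis. h (b::real^3)) = h (axis 1 1) * h (axis 2 1) * h (axis 3 1)"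
proof -
  have B: "(Basis :: (real^3) set) = {axis 1 1, axis 2 1, axis 3 1}"
    by (auto simp: Basis_vec_def exhaust_3) (metis exhaust_3)
  show ?thesis unfolding B by (simp add: axis_eq_axis mult.assoc)
qed

lemma lborel_distr_vec3: "distr lborel borel vec3 = lborel"
proof (rule lborel_eqI[symmetric])
  fix l u :: "real^3"
  assume lu: "\<And>b. b \<in> Basis \<Longrightarrow> l \<bullet> b \<le> u \<bullet> b"
  have le: "l $ i \<le> u $ i" for i using lu[of "axis i 1"] by (simp add: inner_axis)
  have eq: "vec3 -` box l u = box ((l $ 1, l $ 2), l $ 3) ((u $ 1, u $ 2), u $ 3)"
    by (auto simp: mem_box_cart vec3_def forall_3 mem_box Basis_prod_def)
  have "emeasure (distr lborel borel vec3) (box l u) = emeasure lborel (box ((l $ 1, l $ 2), l $ 3) ((u $ 1, u $ 2), u $ 3))"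
    by (simp add: emeasure_distr eq)
  also have "\<dots> = (\<Prod>b\<in>Basis. (u - l) \<bullet> b)"
    using le by (subst emeasure_lborel_box)
      (auto simp: Basis_prod_def prod_Basis_3 inner_axis prod.union_disjoint prod.reindex inj_on_def)
  finally show "emeasure (distr lborel borel vec3) (box l u) = (\<Prod>b\<in>Basis. (u - l) \<bullet> b)" .
qed simp

text \<open>A disc of squared radius a has area pi a. Using the squared norm instead of the norm
  makes the density constant.\<close>

lemma distr_norm_sq_plane:
  "distr (lborel :: (real \<times> real) measure) borel (\<lambda>x. (norm x)^2) = density lborel (\<lambda>a. ennreal pi * indicator {0..} a)"
  (is "?M = ?N")
proof (rule measure_eqI_generator_eq_countable[where E = "range (\<lambda>a. {..a::real})" and A = "range (\<lambda>n::nat. {..real n})" and \<Omega> = UNIV])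
  have M: "emeasure ?M {..a} = ennreal (pi * max 0 a)" for a
  proof (cases "a \<ge> 0")
    case True
    have "(\<lambda>x::real\<times>real. (norm x)^2) -` {..a} = cball 0 (sqrt a)"
      using real_sqrt_le_iff[of "(norm x)^2" a for x :: "real \<times> real"]
      by (intro set_eqI) simp
    then show ?thesis using True
      by (simp add: emeasure_distr emeasure_cball unit_ball_vol_2)
  next
    case False
    then have "(\<lambda>x::real\<times>real. (norm x)^2) -` {..a} = {}"
      by auto (metis norm_ge_zero power2_less_0 not_le order_trans zero_le_power2)
    then show ?thesis using False by (simp add: emeasure_distr)
  qed
  have N: "emeasure ?N {..a} = ennreal (pi * max 0 a)" for a
  proof -
    have "emeasure ?N {..a} = (\<integral>\<^sup>+x. ennreal pi * indicator {0..a} x \<partial>lborel)"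
      by (subst emeasure_density) (auto intro!: nn_integral_cong split: split_indicator)
    also have "\<dots> = ennreal (pi * max 0 a)"
      by (subst nn_integral_cmult) (auto simp: ennreal_mult max_def)
    finally show ?thesis .
  qed
  show "Int_stable (range (\<lambda>a. {..a::real}))" 
    by (auto simp: Int_stable_def)
  show "sets ?M = sigma_sets UNIV (range (\<lambda>a. {..a::real}))" "sets ?N = sigma_sets UNIV (range (\<lambda>a. {..a::real}))"
    by (simp_all add: borel_eq_atMost)
  show "\<And>X. X \<in> range (\<lambda>a. {..a::real}) \<Longrightarrow> emeasure ?M X = emeasure ?N X"
    using M N by auto
  show "\<Union> (range (\<lambda>n::nat. {..real n})) = UNIV"
    using real_arch_simple by auto
  show "\<And>a. a \<in> range (\<lambda>n::nat. {..real n}) \<Longrightarrow> emeasure ?M a \<noteq> \<infinity>"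
    using M by auto
qed auto

lemma norm_vec3: "(norm (vec3 (p, z)))^2 = (norm p)^2 + z^2"
  by (cases p) (simp add: vec3_def norm_vec_def L2_set_def sum_3 norm_prod_def)

lemma norm_axis_diff_vec3: "(norm (axis 3 r - vec3 (p, z)))^2 = (norm p)^2 + (z - r)^2"
  by (cases p) (simp add: vec3_def norm_vec_def L2_set_def sum_3 norm_prod_def axis_def power2_commute)

text \<open>In cylindrical coordinates around the axis through \<open>x\<close>, the pair of squared distances to
  \<open>0\<close> and \<open>x\<close> is an affine function of the squared distance to the axis and of the height.\<close>

lemma nn_integral_bipolar:
  fixes x :: "real^3" and H :: "real \<Rightarrow> real \<Rightarrow> ennreal"
  assumes H [measurable]: "case_prod H \<in> borel_measurable borel" and x: "x \<noteq> 0"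
  defines "r \<equiv> norm x"
  shows "(\<integral>\<^sup>+y. H ((norm y)^2) ((norm (x - y))^2) \<partial>lborel) =
    (\<integral>\<^sup>+a. indicator {0..} a * (ennreal (pi / (2 * r)) *
      (\<integral>\<^sup>+b. H a b * indicator {(sqrt a - r)^2..(sqrt a + r)^2} b \<partial>lborel)) \<partial>lborel)"
proof -
  have r: "r > 0" using x by (simp add: r_def)
  \<comment> \<open>Rotating x onto the third axis preserves Lebesgue measure and both
    distances.\<close>
  have "norm (axis 3 r :: real^3) = norm x"
    by (simp add: norm_vec_def L2_set_def sum_3 axis_def r_def)
  then obtain f :: "real^3 \<Rightarrow> real^3" where f: "orthogonal_transformation f" "f (axis 3 r) = x"
    using orthogonal_transformation_exists[of "axis 3 r" x] by (auto simp: r_def)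
  have lin: "linear f" using f by (simp add: orthogonal_transformation_linear)
  have fm [measurable]: "f \<in> borel_measurable borel"
    using lin by (intro borel_measurable_continuous_onI) (simp add: linear_continuous_on linear_conv_bounded_linear)
  have Hm1 [measurable]: "(\<lambda>w. H (g w) (h w)) \<in> borel_measurable (borel :: (real^3) measure)"
    if [measurable]: "g \<in> borel_measurable borel" "h \<in> borel_measurable borel" for g h
    using measurable_compose[of "\<lambda>w. (g w, h w)" borel borel, OF _ H] by simp
  have Hm2 [measurable]: "(\<lambda>w. H (g w) (h w)) \<in> borel_measurable (borel :: ((real \<times> real) \<times> real) measure)"
    if [measurable]: "g \<in> borel_measurable borel" "h \<in> borel_measurable borel" for g h
    using measurable_compose[of "\<lambda>w. (g w, h w)" borel borel, OF _ H] by simp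
  have Hm3 [measurable]: "(\<lambda>w. H (g w) (h w)) \<in> borel_measurable (borel :: real measure)"
    if [measurable]: "g \<in> borel_measurable borel" "h \<in> borel_measurable borel" for g h
    using measurable_compose[of "\<lambda>w. (g w, h w)" borel borel, OF _ H] by simp
  have Hm4: "(\<lambda>w. H (g w) (h w)) \<in> borel_measurable (borel :: (real \<times> real) measure)"
    if [measurable]: "g \<in> borel_measurable borel" "h \<in> borel_measurable borel" for g h
    using measurable_compose[of "\<lambda>w. (g w, h w)" borel borel, OF _ H] by simp
  have iso: "norm (f y) = norm y" for y using f(1) by (simp add: orthogonal_transformation)
  have diff: "x - f y = f (axis 3 r - y)" for y using lin f(2) by (simp add: linear_diff)
  have "(\<integral>\<^sup>+y. H ((norm y)^2) ((norm (x - y))^2) \<partial>lborel)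
     = (\<integral>\<^sup>+y. H ((norm y)^2) ((norm (x - y))^2) \<partial>distr lborel borel f)"
    by (simp add: lborel_distr_orthogonal[OF f(1)])
  also have "\<dots> = (\<integral>\<^sup>+y. H ((norm y)^2) ((norm (axis 3 r - y :: real^3))^2) \<partial>lborel)"
    by (subst nn_integral_distr) (simp_all add: iso diff)
  also have "\<dots> = (\<integral>\<^sup>+y. H ((norm y)^2) ((norm (axis 3 r - y :: real^3))^2) \<partial>distr lborel borel vec3)"
    by (simp add: lborel_distr_vec3)
  also have "\<dots> = (\<integral>\<^sup>+q. H ((norm (vec3 q))^2) ((norm (axis 3 r - vec3 q :: real^3))^2) \<partial>lborel)"
    by (subst nn_integral_distr) simp_all
  also have "\<dots> = (\<integral>\<^sup>+q. H ((norm (vec3 q))^2) ((norm (axis 3 r - vec3 q :: real^3))^2) \<partial>(lborel \<Otimes>\<^sub>M lborel))"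
    by (simp add: lborel_prod)
  also have "\<dots> = (\<integral>\<^sup>+z. \<integral>\<^sup>+p. H ((norm (p :: real \<times> real))^2 + z^2) ((norm p)^2 + (z - r)^2) \<partial>lborel \<partial>lborel)"
    by (subst lborel_pair.nn_integral_snd[symmetric])
       (simp_all add: norm_vec3 norm_axis_diff_vec3 lborel_prod)
  also have "\<dots> = (\<integral>\<^sup>+z. \<integral>\<^sup>+a. ennreal pi * (indicator {z^2..} a * H a (a - 2 * r * z + r^2)) \<partial>lborel \<partial>lborel)"
  proof (rule nn_integral_cong)
    fix z :: real
    have "(\<integral>\<^sup>+p. H ((norm p)^2 + z^2) ((norm p)^2 + (z - r)^2) \<partial>(lborel :: (real \<times> real) measure))
      = (\<integral>\<^sup>+\<eta>. H (\<eta> + z^2) (\<eta> + (z - r)^2) \<partial>distr (lborel :: (real \<times> real) measure) borel (\<lambda>x. (norm x)^2))"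
      by (subst nn_integral_distr) simp_all
    also have "\<dots> = (\<integral>\<^sup>+\<eta>. ennreal pi * indicator {0..} \<eta> * H (\<eta> + z^2) (\<eta> + (z - r)^2) \<partial>lborel)"
      unfolding distr_norm_sq_plane by (subst nn_integral_density) simp_all
    \<comment> \<open>The shift replaces the squared distance to the axis by a, the squared distance
      to 0. The squared distance to x is then a - 2 r z + r^2, affine in the height z.\<close>
    also have "\<dots> = (\<integral>\<^sup>+a. ennreal pi * indicator {0..} (- (z^2) + 1 * a) * H (- (z^2) + 1 * a + z^2) (- (z^2) + 1 * a + (z - r)^2) \<partial>lborel)"
      by (subst nn_integral_real_affine[where c = 1 and t = "- (z^2)"]) simp_all
    also have "\<dots> = (\<integral>\<^sup>+a. ennreal pi * (indicator {z^2..} a * H a (a - 2 * r * z + r^2)) \<partial>lborel)"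
      by (intro nn_integral_cong) (auto simp: power2_diff algebra_simps split: split_indicator)
    finally show "(\<integral>\<^sup>+p. H ((norm p)^2 + z^2) ((norm p)^2 + (z - r)^2) \<partial>(lborel :: (real \<times> real) measure)) = \<dots>" .
  qed
  also have "\<dots> = (\<integral>\<^sup>+a. \<integral>\<^sup>+z. ennreal pi * (indicator {z^2..} a * H a (a - 2 * r * z + r^2)) \<partial>lborel \<partial>lborel)"
  proof (rule lborel_pair.Fubini')
    have "(\<lambda>w. H (fst w) (fst w - 2 * r * snd w + r^2)) \<in> borel_measurable (borel :: (real \<times> real) measure)"
      by (intro Hm4 borel_measurable_continuous_onI continuous_intros)
    moreover have "(\<lambda>w::real\<times>real. indicator {(snd w)^2..} (fst w) :: ennreal) = indicator {w. (snd w)^2 \<le> fst w}"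
      by (auto simp: fun_eq_iff split: split_indicator)
    moreover have "{w::real\<times>real. (snd w)^2 \<le> fst w} \<in> sets borel"
      by (intro borel_closed closed_Collect_le continuous_intros)
    ultimately have "(\<lambda>w. ennreal pi * (indicator {(snd w)^2..} (fst w) * H (fst w) (fst w - 2 * r * snd w + r^2)))
        \<in> borel_measurable (borel :: (real \<times> real) measure)"
      by (intro borel_measurable_times_ennreal measurable_const) (auto intro: borel_measurable_indicator)
    then show "(\<lambda>(a, z). ennreal pi * (indicator {z^2..} a * H a (a - 2 * r * z + r^2))) \<in> borel_measurable (lborel \<Otimes>\<^sub>M lborel)"
      by (simp add: lborel_prod case_prod_unfold)
  qed
  also have "\<dots> = (\<integral>\<^sup>+a. indicator {0..} a * (ennreal (pi / (2 * r)) *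
      (\<integral>\<^sup>+b. H a b * indicator {(sqrt a - r)^2..(sqrt a + r)^2} b \<partial>lborel)) \<partial>lborel)"
  proof (rule nn_integral_cong)
    fix a :: real
    \<comment> \<open>For a \<ge> 0 this is the triangle inequality: a point at distance sqrt a from
      0 lies at distance between |sqrt a - r| and sqrt a + r from x.\<close>
    have cond: "((a + r^2) / (2 * r) + - 1 / (2 * r) * b)^2 \<le> a \<longleftrightarrow> 0 \<le> a \<and> (sqrt a - r)^2 \<le> b \<and> b \<le> (sqrt a + r)^2" for b
    proof (cases "a \<ge> 0")
      case True
      have "((a + r^2) / (2 * r) + - 1 / (2 * r) * b)^2 \<le> a \<longleftrightarrow> \<bar>(a + r^2) / (2 * r) + - 1 / (2 * r) * b\<bar> \<le> sqrt a"
        using real_sqrt_le_iff[of "((a + r^2) / (2 * r) + - 1 / (2 * r) * b)^2" a] by simp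
      also have "\<dots> \<longleftrightarrow> \<bar>a + r^2 - b\<bar> \<le> 2 * r * sqrt a"
      proof -
        have "(a + r^2) / (2 * r) + - 1 / (2 * r) * b = (a + r^2 - b) / (2 * r)" using r by (simp add: field_simps)
        then show ?thesis using r by (simp add: abs_divide pos_divide_le_eq mult.commute)
      qed
      also have "\<dots> \<longleftrightarrow> (sqrt a - r)^2 \<le> b \<and> b \<le> (sqrt a + r)^2"
        using True by (auto simp: abs_le_iff power2_diff power2_sum algebra_simps)
      finally show ?thesis using True by simp
    next
      case False
      then show ?thesis by (smt (verit) zero_le_power2)
    qed
    have "(\<integral>\<^sup>+z. ennreal pi * (indicator {z^2..} a * H a (a - 2 * r * z + r^2)) \<partial>lborel)
      = ennreal pi * (\<integral>\<^sup>+z. indicator {z. z^2 \<le> a} z * H a (a - 2 * r * z + r^2) \<partial>lborel)"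
      by (subst nn_integral_cmult[symmetric]) (auto intro!: nn_integral_cong split: split_indicator)
    \<comment> \<open>Substitution z = (a + r^2 - b) / (2 r), which trades the height for the
      squared distance b to x.\<close>
    also have "(\<integral>\<^sup>+z. indicator {z. z^2 \<le> a} z * H a (a - 2 * r * z + r^2) \<partial>lborel)
      = ennreal \<bar>- 1 / (2 * r)\<bar> * (\<integral>\<^sup>+b. indicator {z. z^2 \<le> a} ((a + r^2) / (2 * r) + - 1 / (2 * r) * b)
          * H a (a - 2 * r * ((a + r^2) / (2 * r) + - 1 / (2 * r) * b) + r^2) \<partial>lborel)"
      using r by (intro nn_integral_real_affine) simp_all
    also have "(\<integral>\<^sup>+b. indicator {z. z^2 \<le> a} ((a + r^2) / (2 * r) + - 1 / (2 * r) * b)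
          * H a (a - 2 * r * ((a + r^2) / (2 * r) + - 1 / (2 * r) * b) + r^2) \<partial>lborel)
      = (\<integral>\<^sup>+b. indicator {0..} a * (H a b * indicator {(sqrt a - r)^2..(sqrt a + r)^2} b) \<partial>lborel)"
    proof (rule nn_integral_cong)
      fix b
      have "a - 2 * r * ((a + r^2) / (2 * r) + - 1 / (2 * r) * b) + r^2 = b"
        using r by (simp add: field_simps)
      then show "indicator {z. z^2 \<le> a} ((a + r^2) / (2 * r) + - 1 / (2 * r) * b)
          * H a (a - 2 * r * ((a + r^2) / (2 * r) + - 1 / (2 * r) * b) + r^2) 
          = indicator {0..} a * (H a b * indicator {(sqrt a - r)^2..(sqrt a + r)^2} b)"
        using cond[of b] by (auto split: split_indicator)
    qed
    also have "\<dots> = indicator {0..} a * (\<integral>\<^sup>+b. H a b * indicator {(sqrt a - r)^2..(sqrt a + r)^2} b \<partial>lborel)"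
      by (rule nn_integral_cmult) simp
    also have "ennreal pi * (ennreal \<bar>- 1 / (2 * r)\<bar> * \<dots>) = indicator {0..} a * (ennreal (pi / (2 * r)) *
      (\<integral>\<^sup>+b. H a b * indicator {(sqrt a - r)^2..(sqrt a + r)^2} b \<partial>lborel))"
    proof -
      have "ennreal (pi / (2 * r)) = ennreal pi * ennreal \<bar>- 1 / (2 * r)\<bar>"
        using r by (subst ennreal_mult[symmetric]) auto
      then show ?thesis by (simp add: mult_ac)
    qed
    finally show "(\<integral>\<^sup>+z. ennreal pi * (indicator {z^2..} a * H a (a - 2 * r * z + r^2)) \<partial>lborel) = \<dots>" .
  qed
  finally show ?thesis .
qed

section \<open>Gaussian decomposition of the potential\<close>

text \<open>With u = s^2 and the weight s^-4, the quadratic bound gives integrability near 0 and the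
  linear one at infinity.\<close>

lemma exp_minus_bound: fixes u :: real assumes "u \<ge> 0" shows "exp (- u) - 1 + u \<le> u" "exp (- u) - 1 + u \<le> u^2"
proof -
  show "exp (- u) - 1 + u \<le> u" using assms by simp
  have "exp (- u) \<le> 1 / (1 + u)"
    using exp_ge_add_one_self[of u] assms by (simp add: exp_minus field_simps)
  also have "\<dots> \<le> 1 - u + u^2" using assms by (simp add: field_simps power2_eq_square)
  finally show "exp (- u) - 1 + u \<le> u^2" by simp
qed

lemma exp_minus_nonneg: fixes u :: real shows "exp (- u) - 1 + u \<ge> 0"
  using exp_ge_add_one_self[of "- u"] by simp

text \<open>The slice of W at Gaussian parameter t, as a function of the squared norm q. Removing
  the Taylor polynomial 1 - t^2 q makes the weight t^-4, which scaling dictates for |x|^3,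
  integrable at t = 0.\<close>

definition ker :: "real \<Rightarrow> real \<Rightarrow> real \<Rightarrow> real \<Rightarrow> real" where
  "ker a b t q = a * exp (- (t^2 * q)) + b / t^4 * (exp (- (t^2 * q)) - 1 + t^2 * q)"

lemma nn_integral_cubic_finite_pos:
  fixes B :: ennreal
  defines "B \<equiv> (\<integral>\<^sup>+s. ennreal ((exp (- (s^2)) - 1 + s^2) / s^4) * indicator {0<..} s \<partial>lborel)"
  shows "0 < B" "B < \<infinity>"
proof -
  have "(\<integral>\<^sup>+s. ennreal (1 / 27) * indicator {2..3::real} s \<partial>lborel) \<le> B"
    unfolding B_def
  proof (intro nn_integral_mono)
    fix s :: real
    \<comment> \<open>On [2, 3] the numerator is at least 4 - 1 = 3 and the denominator at most
      81.\<close>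
    have "1 / 27 \<le> (exp (- (s^2)) - 1 + s^2) / s^4" if s: "2 \<le> s" "s \<le> 3"
    proof -
      have s4: "s^2 \<ge> 4" and "s^4 \<le> 81" using power_mono[of 2 s 2] power_mono[of s 3 4] s by auto
      moreover have "exp (- (s^2)) - 1 + s^2 \<ge> 3"
        using s4 exp_gt_zero[of "- (s^2)"] by linarith
      then have "27 * 3 \<le> 27 * (exp (- (s^2)) - 1 + s^2)" by (rule mult_left_mono) simp
      ultimately have "s^4 \<le> 27 * (exp (- (s^2)) - 1 + s^2)" by simp
      then show ?thesis using s by (simp add: field_simps)
    qed
    then show "ennreal (1 / 27) * indicator {2..3::real} s \<le> ennreal ((exp (- (s^2)) - 1 + s^2) / s^4) * indicator {0<..} s"
      by (auto split: split_indicator intro!: ennreal_leI)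
  qed
  moreover have "0 < (\<integral>\<^sup>+s. ennreal (1 / 27) * indicator {2..3::real} s \<partial>lborel)"
    by (subst nn_integral_cmult) (auto simp: ennreal_zero_less_mult_iff)
  ultimately show "0 < B" by order
  have "B \<le> (\<integral>\<^sup>+s. indicator {0..1} s + ennreal (1 / s^2) * indicator {1..} (s::real) \<partial>lborel)"
    unfolding B_def
  proof (intro nn_integral_mono)
    fix s :: real
    have "(exp (- (s^2)) - 1 + s^2) / s^4 \<le> 1" "(exp (- (s^2)) - 1 + s^2) / s^4 \<le> 1 / s^2" if "s > 0"
    proof -
      show "(exp (- (s^2)) - 1 + s^2) / s^4 \<le> 1"
        using exp_minus_bound(2)[of "s^2"] that by (simp add: field_simps flip: power_mult)
      have "(exp (- (s^2)) - 1 + s^2) * s^2 \<le> s^2 * s^2"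
        using exp_minus_bound(1)[of "s^2"] by (intro mult_right_mono) auto
      then show "(exp (- (s^2)) - 1 + s^2) / s^4 \<le> 1 / s^2"
        using that by (simp add: field_simps eval_nat_numeral)
    qed
    note le = this
    show "ennreal ((exp (- (s^2)) - 1 + s^2) / s^4) * indicator {0<..} s
        \<le> indicator {0..1} s + ennreal (1 / s^2) * indicator {1..} (s::real)"
    proof -
      consider "s \<le> 0" | "0 < s" "s \<le> 1" | "1 < s" by linarith
      then show ?thesis
      proof cases
        case 2
        then have "ennreal ((exp (- (s^2)) - 1 + s^2) / s^4) \<le> 1" using le(1) by (simp add: ennreal_le_1)
        then show ?thesis using 2 by (simp add: add_increasing2)
      next
        case 3
        then show ?thesis using le(2) by (simp add: ennreal_leI)
      qed simp
    qed
  qed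
  also have "\<dots> = (\<integral>\<^sup>+s. indicator {0..1::real} s \<partial>lborel) + (\<integral>\<^sup>+s. ennreal (1 / s^2) * indicator {1..} (s::real) \<partial>lborel)"
    by (rule nn_integral_add) auto
  also have "(\<integral>\<^sup>+s. ennreal (1 / s^2) * indicator {1..} (s::real) \<partial>lborel) = ennreal (0 - (- 1 / 1))"
  proof (rule nn_integral_FTC_atLeast[where F = "\<lambda>s. - 1 / s"])
    show "((\<lambda>s::real. - 1 / s) \<longlongrightarrow> 0) at_top" by real_asymp
  qed (auto intro!: derivative_eq_intros simp: field_simps power2_eq_square)
  also have "(\<integral>\<^sup>+s. indicator {0..1::real} s \<partial>lborel) = 1" by simp
  finally have "B \<le> 1 + ennreal (0 - (- 1 / 1))" .
  also have "\<dots> < \<infinity>" by (simp add: ennreal_add_less_top)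
  finally show "B < \<infinity>" .
qed

lemma gauss_half_line: "(\<integral>\<^sup>+s. ennreal (exp (- (s^2))) * indicator {0<..} s \<partial>lborel) = ennreal (sqrt pi / 2)"
proof -
  have "(\<integral>\<^sup>+s. ennreal (exp (- (s^2))) * indicator {0<..} s \<partial>lborel) = (\<integral>\<^sup>+s. ennreal (indicator {0..} s *\<^sub>R exp (- (s^2))) \<partial>lborel)"
  proof (rule nn_integral_cong_AE)
    show "AE s in lborel. ennreal (exp (- (s^2))) * indicator {0<..} s = ennreal (indicator {0..} s *\<^sub>R exp (- (s^2)))"
      using AE_lborel_singleton[of 0] by eventually_elim (auto split: split_indicator)
  qed
  also have "\<dots> = ennreal (sqrt pi / 2)"
    using gaussian_moment_0 by (subst nn_integral_eq_integral) (auto simp: has_bochner_integral_iff)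
  finally show ?thesis .
qed

lemma emeasure_half_line: "emeasure lborel {0::real<..} = \<top>"
proof (rule ccontr)
  assume "emeasure lborel {0::real<..} \<noteq> \<top>"
  then obtain c where c: "emeasure lborel {0::real<..} = ennreal c" "0 \<le> c"
    by (cases "emeasure lborel {0::real<..}") auto
  have "emeasure lborel {0<..c + 1} \<le> emeasure lborel {0::real<..}" by (rule emeasure_mono) auto
  then have "ennreal (c + 1) \<le> ennreal c" using c by simp
  then show False using c by (simp add: ennreal_le_iff)
qed

text \<open>Substituting s = t r pulls out r^-1 from the Gaussian part and r^4 / r = r^3 from the
  other. The constants \<open>a\<close> and \<open>b\<close> normalize the two remaining integrals;
  the second enters only through being positive and finite.\<close>

lemma W_eq_nn_integral_ker:
  obtains a b where "a > 0" "b > 0"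
    "\<And>x. W x = (\<integral>\<^sup>+t. ennreal (ker a b t ((norm x)^2)) * indicator {0<..} t \<partial>lborel)"
proof -
  define B where "B = (\<integral>\<^sup>+s. ennreal ((exp (- (s^2)) - 1 + s^2) / s^4) * indicator {0<..} s \<partial>lborel)"
  obtain B' where B': "B = ennreal B'" "B' > 0"
    using nn_integral_cubic_finite_pos unfolding B_def[symmetric] by (cases B) (auto simp: top_unique)
  define a where "a = 1 / (sqrt pi / 2)"
  define b where "b = 1 / (3 * B')"
  have ab: "a > 0" "b > 0" using B' by (auto simp: a_def b_def)
  have "W x = (\<integral>\<^sup>+t. ennreal (ker a b t ((norm x)^2)) * indicator {0<..} t \<partial>lborel)" for x
  proof (cases "x = 0")
    case True
    \<comment> \<open>At the origin the slice is the constant \<open>a\<close>, whose integral over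
      the half line is infinite, matching the value of W there.\<close>
    have "(\<integral>\<^sup>+t. ennreal (ker a b t ((norm x)^2)) * indicator {0<..} t \<partial>lborel) = (\<integral>\<^sup>+t. ennreal a * indicator {0<..} (t::real) \<partial>lborel)"
      by (simp add: ker_def True)
    also have "\<dots> = \<infinity>"
      using ab by (subst nn_integral_cmult) (auto simp: ennreal_mult_eq_top_iff emeasure_half_line)
    finally show ?thesis by (simp add: W_def True)
  next
    case False
    define r where "r = norm x"
    have r: "r > 0" using False by (simp add: r_def)
    have I1: "(\<integral>\<^sup>+t. ennreal (exp (- ((t * r)^2))) * indicator {0<..} t \<partial>lborel) = ennreal (1 / r) * ennreal (sqrt pi / 2)"
    proof -
      have "(\<integral>\<^sup>+t. ennreal (exp (- ((t * r)^2))) * indicator {0<..} t \<partial>lborel)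
        = ennreal \<bar>1 / r\<bar> * (\<integral>\<^sup>+s. ennreal (exp (- (((0 + 1 / r * s) * r)^2))) * indicator {0<..} (0 + 1 / r * s) \<partial>lborel)"
        using r by (intro nn_integral_real_affine) auto
      also have "(\<integral>\<^sup>+s. ennreal (exp (- (((0 + 1 / r * s) * r)^2))) * indicator {0<..} (0 + 1 / r * s) \<partial>lborel)
         = (\<integral>\<^sup>+s. ennreal (exp (- (s^2))) * indicator {0<..} s \<partial>lborel)"
        using r by (intro nn_integral_cong) (auto split: split_indicator simp: zero_less_divide_iff)
      finally show ?thesis using r by (simp add: gauss_half_line)
    qed
    have I2: "(\<integral>\<^sup>+t. ennreal ((exp (- ((t * r)^2)) - 1 + (t * r)^2) / t^4) * indicator {0<..} t \<partial>lborel) = ennreal (r^3) * B"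
    proof -
      have "(\<integral>\<^sup>+t. ennreal ((exp (- ((t * r)^2)) - 1 + (t * r)^2) / t^4) * indicator {0<..} t \<partial>lborel)
        = ennreal \<bar>1 / r\<bar> * (\<integral>\<^sup>+s. ennreal ((exp (- (((0 + 1 / r * s) * r)^2)) - 1 + ((0 + 1 / r * s) * r)^2) / (0 + 1 / r * s)^4) * indicator {0<..} (0 + 1 / r * s) \<partial>lborel)"
        using r by (intro nn_integral_real_affine) auto
      also have "(\<integral>\<^sup>+s. ennreal ((exp (- (((0 + 1 / r * s) * r)^2)) - 1 + ((0 + 1 / r * s) * r)^2) / (0 + 1 / r * s)^4) * indicator {0<..} (0 + 1 / r * s) \<partial>lborel)
         = (\<integral>\<^sup>+s. ennreal (r^4) * (ennreal ((exp (- (s^2)) - 1 + s^2) / s^4) * indicator {0<..} s) \<partial>lborel)"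
        using r exp_minus_nonneg
        by (intro nn_integral_cong) (auto split: split_indicator simp: zero_less_divide_iff power_divide mult.commute simp flip: ennreal_mult')
      also have "\<dots> = ennreal (r^4) * B" unfolding B_def by (rule nn_integral_cmult) auto
      also have "ennreal \<bar>1 / r\<bar> * (ennreal (r^4) * B) = ennreal (r^3) * B"
        using r by (simp add: mult.assoc[symmetric] ennreal_mult'[symmetric] eval_nat_numeral)
      finally show ?thesis .
    qed
    have "(\<integral>\<^sup>+t. ennreal (ker a b t ((norm x)^2)) * indicator {0<..} t \<partial>lborel)
      = (\<integral>\<^sup>+t. ennreal a * (ennreal (exp (- ((t * r)^2))) * indicator {0<..} t)
          + ennreal b * (ennreal ((exp (- ((t * r)^2)) - 1 + (t * r)^2) / t^4) * indicator {0<..} t) \<partial>lborel)"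
    proof (rule nn_integral_cong)
      fix t
      have "ennreal (ker a b t ((norm x)^2)) = ennreal a * ennreal (exp (- ((t * r)^2)))
          + ennreal b * ennreal ((exp (- ((t * r)^2)) - 1 + (t * r)^2) / t^4)"
        using ab exp_minus_nonneg[of "(t * r)^2"]
        by (simp add: ker_def r_def[symmetric] power_mult_distrib flip: ennreal_mult ennreal_plus)
      then show "ennreal (ker a b t ((norm x)^2)) * indicator {0<..} t = ennreal a * (ennreal (exp (- ((t * r)^2))) * indicator {0<..} t)
          + ennreal b * (ennreal ((exp (- ((t * r)^2)) - 1 + (t * r)^2) / t^4) * indicator {0<..} t)"
        by (simp add: algebra_simps)
    qed
    also have "\<dots> = ennreal a * (ennreal (1 / r) * ennreal (sqrt pi / 2)) + ennreal b * (ennreal (r^3) * B)"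
      unfolding I1[symmetric] I2[symmetric] by (subst nn_integral_add) (simp_all add: nn_integral_cmult)
    also have "\<dots> = ennreal (1 / r + r^3 / 3)"
    proof -
      have "a * (1 / r * (sqrt pi / 2)) = 1 / r" "b * (r^3 * B') = r^3 / 3"
        using B' by (auto simp: a_def b_def field_simps)
      then show ?thesis
        using r ab B' unfolding B'(1)
        by (subst ennreal_mult[symmetric], simp, simp)+ (simp flip: ennreal_plus)
    qed
    finally show ?thesis using False by (simp add: W_def r_def add.commute)
  qed
  then show ?thesis using that ab by blast
qed

lemma nn_integral_gaussian_finite_pos:
  fixes c :: real
  assumes "c > 0"
  defines "K \<equiv> (\<integral>\<^sup>+w. ennreal (exp (- (c * (norm w)^2))) \<partial>(lborel :: (real^3) measure))"
  shows "K \<noteq> 0" "K < \<infinity>"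
proof -
  define G where "G = (\<integral>\<^sup>+x. ennreal (exp (- (c * x^2))) \<partial>lborel)"
  define \<sigma> where "\<sigma> = sqrt (1 / (2 * c))"
  have \<sigma>: "\<sigma> > 0" "\<sigma>^2 = 1 / (2 * c)" using assms by (auto simp: \<sigma>_def)
  interpret N: prob_space "density lborel (normal_density 0 \<sigma>)"
    using \<sigma> by (intro prob_space_normal_density)
  have "exp (- (c * x^2)) = sqrt (2 * pi * \<sigma>^2) * normal_density 0 \<sigma> x" for x
    using \<sigma> assms by (simp add: normal_density_def field_simps)
  then have "G = (\<integral>\<^sup>+x. ennreal (sqrt (2 * pi * \<sigma>^2)) * ennreal (normal_density 0 \<sigma> x) \<partial>lborel)"
    unfolding G_def by (simp add: ennreal_mult)
  also have "\<dots> = ennreal (sqrt (2 * pi * \<sigma>^2)) * (\<integral>\<^sup>+x. ennreal (normal_density 0 \<sigma> x) \<partial>lborel)"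
    by (rule nn_integral_cmult) simp
  also have "(\<integral>\<^sup>+x. ennreal (normal_density 0 \<sigma> x) \<partial>lborel) = 1"
    using N.emeasure_space_1 by (simp add: emeasure_density)
  finally have G: "G = ennreal (sqrt (2 * pi * \<sigma>^2))" by simp
  have "K = (\<integral>\<^sup>+w. (\<Prod>b\<in>Basis. ennreal (exp (- (c * (w \<bullet> b)^2)))) \<partial>(lborel :: (real^3) measure))"
    unfolding K_def
    by (subst prod_ennreal)
       (simp_all add: norm_eq_sqrt_inner euclidean_inner[of w w for w :: "real^3"] sum_nonneg sum_distrib_left sum_negf
         power2_eq_square flip: exp_sum)
  also have "\<dots> = (\<Prod>b\<in>(Basis :: (real^3) set). G)"
    unfolding G_def by (rule nn_integral_lborel_prod) simp_all
  also have "\<dots> = ennreal (sqrt (2 * pi * \<sigma>^2) ^ 3)"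
    unfolding G by (simp add: ennreal_power)
  finally have "K = ennreal (sqrt (2 * pi * \<sigma>^2) ^ 3)" .
  then show "K \<noteq> 0" "K < \<infinity>" using \<sigma>(1) by auto
qed

section \<open>Convexity of the interaction\<close>

definition interaction :: "(real^3) measure \<Rightarrow> (real^3) measure \<Rightarrow> ennreal" where
  "interaction \<mu> \<nu> = (\<integral>\<^sup>+x. \<integral>\<^sup>+y. W (x - y) \<partial>\<nu> \<partial>\<mu>)"

definition gauss_form :: "real \<Rightarrow> (real^3) measure \<Rightarrow> (real^3) measure \<Rightarrow> ennreal" where
  "gauss_form t \<mu> \<nu> = (\<integral>\<^sup>+x. \<integral>\<^sup>+y. ennreal (exp (- (t^2 * (norm (x - y))^2))) \<partial>\<nu> \<partial>\<mu>)"

text \<open>The exponent 2 t^2 makes this Gaussian a convolution square root: two of them, centred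
  at x and y, have a product whose integral is exp(-t^2 |x - y|^2) times
  \<open>gauss_mass t\<close>.\<close>

definition smooth :: "real \<Rightarrow> (real^3) measure \<Rightarrow> real^3 \<Rightarrow> ennreal" where
  "smooth t \<mu> z = (\<integral>\<^sup>+x. ennreal (exp (- (2 * t^2 * (norm (x - z))^2))) \<partial>\<mu>)"

definition gauss_mass :: "real \<Rightarrow> ennreal" where
  "gauss_mass t = (\<integral>\<^sup>+w. ennreal (exp (- (4 * t^2 * (norm w)^2))) \<partial>(lborel :: (real^3) measure))"

text \<open>A squared L2 distance. The passage to reals avoids truncated subtraction and loses
  nothing for probability measures, whose mollifications are at most 1.\<close>

definition smooth_dist :: "real \<Rightarrow> (real^3) measure \<Rightarrow> (real^3) measure \<Rightarrow> ennreal" where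
  "smooth_dist t \<mu> \<nu> = (\<integral>\<^sup>+z. ennreal ((enn2real (smooth t \<mu> z) - enn2real (smooth t \<nu> z))^2) \<partial>lborel)"

text \<open>The Bochner integral of a non-integrable function is 0 by default; for a probability
  measure integrable squares make the identity integrable, so the last clause is a genuine
  mean.\<close>

definition centered :: "(real^3) measure \<Rightarrow> bool" where
  "centered \<mu> \<longleftrightarrow> borel_prob \<mu> \<and> integrable \<mu> (\<lambda>x. (norm x)^2) \<and> (\<integral>x. x \<partial>\<mu>) = 0"

lemma gauss_mass: assumes "t > 0" shows "gauss_mass t \<noteq> 0" "gauss_mass t < \<infinity>"
  unfolding gauss_mass_def using nn_integral_gaussian_finite_pos[of "4 * t^2"] assms by auto

lemma W_measurable [measurable]: "W \<in> borel_measurable borel"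
  unfolding W_def[abs_def] by measurable

lemma nn_integral_lborel_translate:
  fixes f :: "'a::euclidean_space \<Rightarrow> ennreal"
  assumes [measurable]: "f \<in> borel_measurable borel"
  shows "(\<integral>\<^sup>+z. f (c + z) \<partial>lborel) = (\<integral>\<^sup>+z. f z \<partial>lborel)"
  using nn_integral_distr[of "(+) c" lborel borel f] by (simp add: lborel_distr_plus)

text \<open>The parallelogram law for the midpoint of \<open>x\<close> and \<open>y\<close>.\<close>

lemma gauss_product:
  fixes x y :: "real^3"
  shows "(\<integral>\<^sup>+z. ennreal (exp (- (2 * t^2 * (norm (x - z))^2))) * ennreal (exp (- (2 * t^2 * (norm (y - z))^2))) \<partial>lborel)
    = ennreal (exp (- (t^2 * (norm (x - y))^2))) * gauss_mass t"
proof -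
  define m where "m = (1/2) *\<^sub>R (x + y)"
  have "(\<integral>\<^sup>+z. ennreal (exp (- (2 * t^2 * (norm (x - z))^2))) * ennreal (exp (- (2 * t^2 * (norm (y - z))^2))) \<partial>lborel)
    = (\<integral>\<^sup>+z. ennreal (exp (- (2 * t^2 * (norm (x - (m + z)))^2))) * ennreal (exp (- (2 * t^2 * (norm (y - (m + z)))^2))) \<partial>lborel)"
    by (rule nn_integral_lborel_translate[symmetric]) measurable
  also have "\<dots> = (\<integral>\<^sup>+z. ennreal (exp (- (t^2 * (norm (x - y))^2))) * ennreal (exp (- (4 * t^2 * (norm (z :: real^3))^2))) \<partial>lborel)"
  proof (rule nn_integral_cong)
    fix z :: "real^3"
    define d where "d = (1/2) *\<^sub>R (x - y)"
    have "x - (m + z) = d - z" "y - (m + z) = - (d + z)" "x - y = 2 *\<^sub>R d"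
      by (simp_all add: m_def d_def algebra_simps vec_eq_iff)
    then have "2 * t^2 * (norm (x - (m + z)))^2 + 2 * t^2 * (norm (y - (m + z)))^2 = t^2 * (norm (x - y))^2 + 4 * t^2 * (norm z)^2"
      by (simp only: norm_minus_cancel power2_norm_eq_inner) (simp add: inner_diff inner_add inner_commute algebra_simps)
    then have "exp (- (2 * t^2 * (norm (x - (m + z)))^2)) * exp (- (2 * t^2 * (norm (y - (m + z)))^2))
      = exp (- (t^2 * (norm (x - y))^2)) * exp (- (4 * t^2 * (norm z)^2))"
      by (simp flip: exp_add)
    then show "ennreal (exp (- (2 * t^2 * (norm (x - (m + z)))^2))) * ennreal (exp (- (2 * t^2 * (norm (y - (m + z)))^2)))
      = ennreal (exp (- (t^2 * (norm (x - y))^2))) * ennreal (exp (- (4 * t^2 * (norm z)^2)))"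
      by (simp flip: ennreal_mult')
  qed
  also have "\<dots> = ennreal (exp (- (t^2 * (norm (x - y))^2))) * gauss_mass t"
    unfolding gauss_mass_def by (rule nn_integral_cmult) measurable
  finally show ?thesis .
qed

locale borel_prob_pair =
  fixes \<mu> \<nu> :: "(real^3) measure"
  assumes bp: "borel_prob \<mu>" "borel_prob \<nu>"
begin

sublocale M: prob_space \<mu> using bp by (simp add: borel_prob_def)
sublocale N: prob_space \<nu> using bp by (simp add: borel_prob_def)

lemma sets_M [measurable_cong]: "sets \<mu> = sets borel" and sets_N [measurable_cong]: "sets \<nu> = sets borel"
  using bp by (auto simp: borel_prob_def)

lemma space_M [simp]: "space \<mu> = UNIV" and space_N [simp]: "space \<nu> = UNIV"
  using sets_eq_imp_space_eq[OF sets_M] sets_eq_imp_space_eq[OF sets_N] by auto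

sublocale LM: pair_sigma_finite "lborel :: (real^3) measure" \<mu> ..
sublocale LN: pair_sigma_finite "lborel :: (real^3) measure" \<nu> ..
sublocale TM: pair_sigma_finite "lborel :: real measure" \<mu> ..
sublocale TN: pair_sigma_finite "lborel :: real measure" \<nu> ..

lemma smooth_measurable [measurable]: 
  "(\<lambda>(t, z). smooth t \<mu> z) \<in> borel_measurable (borel \<Otimes>\<^sub>M borel)" 
  "(\<lambda>(t, z). smooth t \<nu> z) \<in> borel_measurable (borel \<Otimes>\<^sub>M borel)" 
  unfolding smooth_def by measurable

lemma smooth_le_1: "smooth t \<mu> z \<le> 1" "smooth t \<nu> z \<le> 1"
proof -
  have "smooth t \<mu> z \<le> (\<integral>\<^sup>+x. 1 \<partial>\<mu>)" unfolding smooth_def by (rule nn_integral_mono) simp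
  then show "smooth t \<mu> z \<le> 1" by (simp add: M.emeasure_space_1[simplified])
  have "smooth t \<nu> z \<le> (\<integral>\<^sup>+x. 1 \<partial>\<nu>)" unfolding smooth_def by (rule nn_integral_mono) simp
  then show "smooth t \<nu> z \<le> 1" by (simp add: N.emeasure_space_1[simplified])
qed

text \<open>Replacing the Gaussian of x - y by the integral from \<open>gauss_product\<close>
  decouples x and y, and Tonelli's theorem lets each be integrated alone for fixed z.\<close>

lemma gauss_form_eq: "gauss_form t \<mu> \<nu> * gauss_mass t = (\<integral>\<^sup>+z. smooth t \<mu> z * smooth t \<nu> z \<partial>lborel)"
proof -
  let ?g = "\<lambda>x z. ennreal (exp (- (2 * t^2 * (norm (x - z :: real^3))^2)))"
  have "gauss_form t \<mu> \<nu> * gauss_mass t = (\<integral>\<^sup>+x. \<integral>\<^sup>+y. \<integral>\<^sup>+z. ?g x z * ?g y z \<partial>lborel \<partial>\<nu> \<partial>\<mu>)"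
    unfolding gauss_product gauss_form_def by (simp add: nn_integral_multc)
  also have "\<dots> = (\<integral>\<^sup>+x. \<integral>\<^sup>+z. \<integral>\<^sup>+y. ?g x z * ?g y z \<partial>\<nu> \<partial>lborel \<partial>\<mu>)"
    by (intro nn_integral_cong LN.Fubini') measurable
  also have "\<dots> = (\<integral>\<^sup>+x. \<integral>\<^sup>+z. ?g x z * smooth t \<nu> z \<partial>lborel \<partial>\<mu>)"
    unfolding smooth_def by (simp add: nn_integral_cmult)
  also have "\<dots> = (\<integral>\<^sup>+z. \<integral>\<^sup>+x. ?g x z * smooth t \<nu> z \<partial>\<mu> \<partial>lborel)"
    by (intro LM.Fubini') measurable
  also have "\<dots> = (\<integral>\<^sup>+z. smooth t \<mu> z * smooth t \<nu> z \<partial>lborel)"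
    by (subst (2) smooth_def) (simp add: nn_integral_multc)
  finally show ?thesis .
qed

lemma swapped: "borel_prob_pair \<nu> \<mu>" "borel_prob_pair \<mu> \<mu>" "borel_prob_pair \<nu> \<nu>"
  using bp by (auto intro: borel_prob_pair.intro)

text \<open>Positive definiteness in additive form: integrate s^2 + r^2 = 2 s r + (s - r)^2 for the
  two mollifications and divide by \<open>gauss_mass t\<close>, which is positive and
  finite.\<close>

lemma gauss_form_polarization:
  assumes "t > 0"
  shows "gauss_form t \<mu> \<mu> + gauss_form t \<nu> \<nu> = 2 * gauss_form t \<mu> \<nu> + smooth_dist t \<mu> \<nu> / gauss_mass t"
proof -
  have sq: "s * s + r * r = 2 * (s * r) + ennreal ((enn2real s - enn2real r)^2)" if "s \<le> 1" "r \<le> 1" for s r :: ennreal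
  proof -
    have "s < \<top>" "r < \<top>" using that by (auto intro: le_less_trans)
    then obtain s' r' where sr: "s = ennreal s'" "r = ennreal r'" "0 \<le> s'" "0 \<le> r'"
      by (metis ennreal_enn2real enn2real_nonneg)
    then have "ennreal (s' * s' + r' * r') = ennreal (2 * (s' * r') + (s' - r')^2)"
      by (simp add: power2_eq_square algebra_simps)
    then show ?thesis using sr by (simp add: ennreal_mult)
  qed
  have "(gauss_form t \<mu> \<mu> + gauss_form t \<nu> \<nu>) * gauss_mass t
     = (\<integral>\<^sup>+z. smooth t \<mu> z * smooth t \<mu> z + smooth t \<nu> z * smooth t \<nu> z \<partial>lborel)"
    using swapped[THEN borel_prob_pair.gauss_form_eq, of t]
    by (subst nn_integral_add) (simp_all add: distrib_right)
  also have "\<dots> = (\<integral>\<^sup>+z. 2 * (smooth t \<mu> z * smooth t \<nu> z) + ennreal ((enn2real (smooth t \<mu> z) - enn2real (smooth t \<nu> z))^2) \<partial>lborel)"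
    using sq smooth_le_1 by (intro nn_integral_cong) auto
  also have "\<dots> = 2 * (\<integral>\<^sup>+z. smooth t \<mu> z * smooth t \<nu> z \<partial>lborel) + smooth_dist t \<mu> \<nu>"
    unfolding smooth_dist_def by (subst nn_integral_add) (simp_all add: nn_integral_cmult)
  also have "\<dots> = 2 * (gauss_form t \<mu> \<nu> * gauss_mass t) + smooth_dist t \<mu> \<nu>"
    by (simp add: gauss_form_eq)
  finally have "(gauss_form t \<mu> \<mu> + gauss_form t \<nu> \<nu>) * gauss_mass t / gauss_mass t
    = (2 * gauss_form t \<mu> \<nu>) * gauss_mass t / gauss_mass t + smooth_dist t \<mu> \<nu> / gauss_mass t"
    by (simp add: add_divide_distrib_ennreal mult.assoc)
  then show ?thesis
    using gauss_mass[OF assms] by (simp add: ennreal_mult_divide_eq)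
qed

end

section \<open>Second moments and polarization of the full kernel\<close>

lemma centered_borel_prob: "centered \<mu> \<Longrightarrow> borel_prob \<mu>" by (simp add: centered_def)

lemma integrable_id_of_square:
  fixes \<mu> :: "(real^3) measure"
  assumes "borel_prob \<mu>" "integrable \<mu> (\<lambda>x. (norm x)^2)" 
  shows "integrable \<mu> (\<lambda>x. x)"
proof -
  interpret prob_space \<mu> using assms by (simp add: borel_prob_def)
  have [measurable_cong]: "sets \<mu> = sets borel" using assms by (simp add: borel_prob_def)
  show ?thesis
  proof (rule Bochner_Integration.integrable_bound[where f = "\<lambda>x. 1 + (norm x)^2"])
    show "integrable \<mu> (\<lambda>x. 1 + (norm x)^2)" using assms by simp
    have "norm x \<le> 1 + (norm x)^2" for x :: "real^3"
      using zero_le_power2[of "norm x - 1"] by (simp add: power2_diff) (smt (verit) norm_ge_zero zero_le_power2)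
    then show "AE x in \<mu>. norm x \<le> norm (1 + (norm x)^2)" by simp
  qed measurable
qed

text \<open>Expanding the square, the cross term -2 (x \<bullet> y) integrates to 0 because the mean
  of \<nu> is 0.\<close>

lemma centered_second_moment:
  assumes "centered \<mu>" "centered \<nu>"
  shows "(\<integral>\<^sup>+x. \<integral>\<^sup>+y. ennreal ((norm (x - y))^2) \<partial>\<nu> \<partial>\<mu>) = ennreal ((\<integral>x. (norm x)^2 \<partial>\<mu>) + (\<integral>x. (norm x)^2 \<partial>\<nu>))"
proof -
  interpret borel_prob_pair \<mu> \<nu> using assms by (auto intro: borel_prob_pair.intro centered_borel_prob)
  have i2 [simp]: "integrable \<mu> (\<lambda>x. (norm x)^2)" "integrable \<nu> (\<lambda>x. (norm x)^2)" using assms by (auto simp: centered_def)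
  have i1 [simp]: "integrable \<mu> (\<lambda>x. x)" "integrable \<nu> (\<lambda>x. x)" 
    using integrable_id_of_square bp i2 by auto
  define m2 where "m2 = (\<integral>x. (norm x)^2 \<partial>\<nu>)"
  have m2: "m2 \<ge> 0" by (simp add: m2_def)
  have "(\<integral>\<^sup>+y. ennreal ((norm (x - y))^2) \<partial>\<nu>) = ennreal ((norm x)^2 + m2)" for x
  proof -
    have eq: "(norm (x - y))^2 = (norm x)^2 + (norm y)^2 - 2 * (x \<bullet> y)" for y
      by (simp add: power2_norm_eq_inner inner_diff inner_commute)
    have "integrable \<nu> (\<lambda>y. (norm (x - y))^2)" unfolding eq by simp
    then have "(\<integral>\<^sup>+y. ennreal ((norm (x - y))^2) \<partial>\<nu>) = ennreal (\<integral>y. (norm (x - y))^2 \<partial>\<nu>)"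
      by (intro nn_integral_eq_integral) auto
    also have "(\<integral>y. (norm (x - y))^2 \<partial>\<nu>) = (norm x)^2 + m2 - 2 * (x \<bullet> (\<integral>y. y \<partial>\<nu>))"
      unfolding eq m2_def by (simp add: N.prob_space[simplified])
    finally show ?thesis using assms by (simp add: centered_def)
  qed
  then have "(\<integral>\<^sup>+x. \<integral>\<^sup>+y. ennreal ((norm (x - y))^2) \<partial>\<nu> \<partial>\<mu>) = (\<integral>\<^sup>+x. ennreal ((norm x)^2 + m2) \<partial>\<mu>)"
    by simp
  also have "\<dots> = ennreal (\<integral>x. (norm x)^2 + m2 \<partial>\<mu>)"
    using m2 by (intro nn_integral_eq_integral) auto
  also have "(\<integral>x. (norm x)^2 + m2 \<partial>\<mu>) = (\<integral>x. (norm x)^2 \<partial>\<mu>) + m2"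
    by (simp add: M.prob_space[simplified])
  finally show ?thesis by (simp add: m2_def)
qed

definition ker_form :: "real \<Rightarrow> real \<Rightarrow> real \<Rightarrow> (real^3) measure \<Rightarrow> (real^3) measure \<Rightarrow> ennreal" where
  "ker_form a b t \<mu> \<nu> = (\<integral>\<^sup>+x. \<integral>\<^sup>+y. ennreal (ker a b t ((norm (x - y))^2)) \<partial>\<nu> \<partial>\<mu>)"

lemma ker_nonneg: "a \<ge> 0 \<Longrightarrow> b \<ge> 0 \<Longrightarrow> ker a b t q \<ge> 0"
  unfolding ker_def using exp_minus_nonneg[of "t^2 * q"] by simp

context borel_prob_pair
begin

text \<open>The constant -b / t^4 of the kernel is moved to the other side, so that only nonnegative
  terms occur.\<close>

lemma ker_form_eq:
  assumes "t > 0" "a > 0" "b > 0"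
  shows "ker_form a b t \<mu> \<nu> + ennreal (b / t^4) = ennreal (a + b / t^4) * gauss_form t \<mu> \<nu>
     + ennreal (b / t^2) * (\<integral>\<^sup>+x. \<integral>\<^sup>+y. ennreal ((norm (x - y))^2) \<partial>\<nu> \<partial>\<mu>)"
proof -
  have [measurable]: "ker a b t \<in> borel_measurable borel" unfolding ker_def[abs_def] by measurable
  have "ker_form a b t \<mu> \<nu> + ennreal (b / t^4) = (\<integral>\<^sup>+x. \<integral>\<^sup>+y. ennreal (ker a b t ((norm (x - y))^2)) + ennreal (b / t^4) \<partial>\<nu> \<partial>\<mu>)"
    unfolding ker_form_def
    by (simp add: nn_integral_add M.emeasure_space_1[simplified] N.emeasure_space_1[simplified])
  also have "\<dots> = (\<integral>\<^sup>+x. \<integral>\<^sup>+y. ennreal (a + b / t^4) * ennreal (exp (- (t^2 * (norm (x - y))^2)))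
      + ennreal (b / t^2) * ennreal ((norm (x - y))^2) \<partial>\<nu> \<partial>\<mu>)"
  proof (intro nn_integral_cong)
    fix x y :: "real^3"
    have "ker a b t ((norm (x - y))^2) + b / t^4 = (a + b / t^4) * exp (- (t^2 * (norm (x - y))^2)) + b / t^2 * (norm (x - y))^2"
    proof -
      have t: "b / t^4 * t^2 = b / t^2" using assms by (simp add: eval_nat_numeral)
      have "ker a b t q + b / t^4 = (a + b / t^4) * exp (- (t^2 * q)) + (b / t^4 * t^2) * q" for q
        unfolding ker_def by (simp only: algebra_simps)
      then show ?thesis unfolding t .
    qed
    then have "ennreal (ker a b t ((norm (x - y))^2) + b / t^4) =
        ennreal ((a + b / t^4) * exp (- (t^2 * (norm (x - y))^2)) + b / t^2 * (norm (x - y))^2)"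
      by (rule arg_cong)
    moreover have "0 \<le> ker a b t ((norm (x - y))^2)" "0 \<le> b / t^4" "0 \<le> b / t^2" "0 \<le> a + b / t^4"
      using assms by (auto intro: ker_nonneg)
    ultimately show "ennreal (ker a b t ((norm (x - y))^2)) + ennreal (b / t^4) = ennreal (a + b / t^4) * ennreal (exp (- (t^2 * (norm (x - y))^2)))
      + ennreal (b / t^2) * ennreal ((norm (x - y))^2)"
      by (simp only: ennreal_plus ennreal_mult exp_ge_zero zero_le_power2 mult_nonneg_nonneg)
  qed
  also have "\<dots> = ennreal (a + b / t^4) * gauss_form t \<mu> \<nu>
     + ennreal (b / t^2) * (\<integral>\<^sup>+x. \<integral>\<^sup>+y. ennreal ((norm (x - y))^2) \<partial>\<nu> \<partial>\<mu>)"
    unfolding gauss_form_def by (simp add: nn_integral_add nn_integral_cmult)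
  finally show ?thesis .
qed

text \<open>For centered measures the second moment form is additive in the two measures, so it
  satisfies the polarization identity without remainder and only the Gaussian part
  contributes.\<close>

lemma ker_form_polarization:
  assumes t: "t > 0" "a > 0" "b > 0" and c: "centered \<mu>" "centered \<nu>"
  shows "ker_form a b t \<mu> \<mu> + ker_form a b t \<nu> \<nu> = 2 * ker_form a b t \<mu> \<nu>
     + ennreal (a + b / t^4) * (smooth_dist t \<mu> \<nu> / gauss_mass t)"
proof -
  let ?S = "\<lambda>\<mu> \<nu>. (\<integral>\<^sup>+x. \<integral>\<^sup>+y. ennreal ((norm (x - y :: real^3))^2) \<partial>\<nu> \<partial>\<mu>)"
  let ?c = "ennreal (b / t^4)" and ?d = "ennreal (a + b / t^4)" and ?e = "ennreal (b / t^2)"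
  let ?E = "smooth_dist t \<mu> \<nu> / gauss_mass t"
  have S: "?S \<mu> \<mu> + ?S \<nu> \<nu> = 2 * ?S \<mu> \<nu>"
  proof -
    define m n where "m = (\<integral>x. (norm x)^2 \<partial>\<mu>)" and "n = (\<integral>x. (norm x)^2 \<partial>\<nu>)"
    have mn: "0 \<le> m" "0 \<le> n" by (auto simp: m_def n_def)
    have "ennreal (m + m) + ennreal (n + n) = ennreal ((m + n) + (m + n))"
      using mn by (subst ennreal_plus[symmetric]) (auto simp only: add_ac add_nonneg_nonneg)
    also have "\<dots> = 2 * ennreal (m + n)"
      using mn by (simp only: ennreal_plus[of "m + n" "m + n"] add_nonneg_nonneg mult_2)
    finally show ?thesis
      unfolding centered_second_moment[OF c] centered_second_moment[OF c(1) c(1)] centered_second_moment[OF c(2) c(2)]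
      by (simp only: m_def n_def)
  qed
  have "(ker_form a b t \<mu> \<mu> + ker_form a b t \<nu> \<nu>) + 2 * ?c = (ker_form a b t \<mu> \<mu> + ?c) + (ker_form a b t \<nu> \<nu> + ?c)"
    by (simp only: mult_2 add_ac)
  also have "\<dots> = ?d * (gauss_form t \<mu> \<mu> + gauss_form t \<nu> \<nu>) + ?e * (?S \<mu> \<mu> + ?S \<nu> \<nu>)"
    unfolding swapped[THEN borel_prob_pair.ker_form_eq[OF _ t]] by (simp only: distrib_left add_ac)
  also have "\<dots> = 2 * (?d * gauss_form t \<mu> \<nu> + ?e * ?S \<mu> \<nu>) + ?d * ?E"
    unfolding S gauss_form_polarization[OF t(1)] by (simp only: distrib_left mult_ac add_ac)
  also have "\<dots> = (2 * ker_form a b t \<mu> \<nu> + ?d * ?E) + 2 * ?c"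
    unfolding ker_form_eq[OF t, symmetric] by (simp only: distrib_left add_ac)
  finally have "2 * ?c + (ker_form a b t \<mu> \<mu> + ker_form a b t \<nu> \<nu>) = 2 * ?c + (2 * ker_form a b t \<mu> \<nu> + ?d * ?E)"
    by (simp only: add.commute)
  \<comment> \<open>Cancellation is sound because \<open>2 * ?c\<close> is finite; the forms
    themselves may be infinite.\<close>
  then show ?thesis
    by (subst (asm) ennreal_add_left_cancel) (auto simp: ennreal_mult_eq_top_iff)
qed

lemma interaction_eq_ker_form:
  assumes W: "\<And>x. W x = (\<integral>\<^sup>+t. ennreal (ker a b t ((norm x)^2)) * indicator {0<..} t \<partial>lborel)"
  shows "interaction \<mu> \<nu> = (\<integral>\<^sup>+t. ker_form a b t \<mu> \<nu> * indicator {0<..} t \<partial>lborel)"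
proof -
  let ?k = "\<lambda>t x y. ennreal (ker a b t ((norm (x - y :: real^3))^2)) * indicator {0<..} t"
  have km: "(\<lambda>(t, y). ?k t x y) \<in> borel_measurable (lborel \<Otimes>\<^sub>M \<nu>)" for x
    unfolding ker_def by measurable
  have "interaction \<mu> \<nu> = (\<integral>\<^sup>+x. \<integral>\<^sup>+t. \<integral>\<^sup>+y. ?k t x y \<partial>\<nu> \<partial>lborel \<partial>\<mu>)"
    unfolding interaction_def W using km by (intro nn_integral_cong TN.Fubini')
  also have "\<dots> = (\<integral>\<^sup>+t. \<integral>\<^sup>+x. \<integral>\<^sup>+y. ?k t x y \<partial>\<nu> \<partial>\<mu> \<partial>lborel)"
    unfolding ker_def by (intro TM.Fubini') measurable
  also have "\<dots> = (\<integral>\<^sup>+t. ker_form a b t \<mu> \<nu> * indicator {0<..} t \<partial>lborel)"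
    unfolding ker_form_def by (intro nn_integral_cong) (simp split: split_indicator)
  finally show ?thesis .
qed

lemma smooth_dist_measurable [measurable]: "(\<lambda>t. smooth_dist t \<mu> \<nu>) \<in> borel_measurable borel"
  unfolding smooth_dist_def by measurable

lemma gauss_mass_measurable [measurable]: "gauss_mass \<in> borel_measurable borel"
  unfolding gauss_mass_def[abs_def] by measurable

lemma ker_form_measurable [measurable]: "(\<lambda>t. ker_form a b t \<mu> \<nu>) \<in> borel_measurable borel"
  "(\<lambda>t. ker_form a b t \<mu> \<mu>) \<in> borel_measurable borel" "(\<lambda>t. ker_form a b t \<nu> \<nu>) \<in> borel_measurable borel"
  unfolding ker_form_def ker_def by measurable

lemma interaction_polarization:
  assumes c: "centered \<mu>" "centered \<nu>"
  obtains a b where "a > 0" "b > 0"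
    "interaction \<mu> \<mu> + interaction \<nu> \<nu> = 2 * interaction \<mu> \<nu>
      + (\<integral>\<^sup>+t. ennreal (a + b / t^4) * (smooth_dist t \<mu> \<nu> / gauss_mass t) * indicator {0<..} t \<partial>lborel)"
proof -
  obtain a b where ab: "a > 0" "b > 0" and W: "\<And>x. W x = (\<integral>\<^sup>+t. ennreal (ker a b t ((norm x)^2)) * indicator {0<..} t \<partial>lborel)"
    using W_eq_nn_integral_ker by blast
  have "interaction \<mu> \<mu> + interaction \<nu> \<nu> = (\<integral>\<^sup>+t. ker_form a b t \<mu> \<mu> * indicator {0<..} t + ker_form a b t \<nu> \<nu> * indicator {0<..} t \<partial>lborel)"
    using swapped[THEN borel_prob_pair.interaction_eq_ker_form[OF _ W]] by (simp add: nn_integral_add)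
  also have "\<dots> = (\<integral>\<^sup>+t. 2 * (ker_form a b t \<mu> \<nu> * indicator {0<..} t) + ennreal (a + b / t^4) * (smooth_dist t \<mu> \<nu> / gauss_mass t) * indicator {0<..} t \<partial>lborel)"
    using ker_form_polarization[OF _ ab c] by (intro nn_integral_cong) (simp split: split_indicator)
  also have "\<dots> = 2 * interaction \<mu> \<nu> + (\<integral>\<^sup>+t. ennreal (a + b / t^4) * (smooth_dist t \<mu> \<nu> / gauss_mass t) * indicator {0<..} t \<partial>lborel)"
    unfolding interaction_eq_ker_form[OF W] by (simp add: nn_integral_add nn_integral_cmult)
  finally show ?thesis using that ab by blast
qed

end

section \<open>Recovering a measure from its mollifications\<close>

lemma nn_integral_lborel_scale:
  fixes f :: "real^3 \<Rightarrow> ennreal"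
  assumes [measurable]: "f \<in> borel_measurable borel" and c: "c \<noteq> 0"
  shows "(\<integral>\<^sup>+z. f z \<partial>lborel) = ennreal (\<bar>c\<bar>^3) * (\<integral>\<^sup>+v. f (c *\<^sub>R v) \<partial>lborel)"
  by (subst lborel_affine[OF c, of 0]) (simp add: nn_integral_density nn_integral_distr nn_integral_cmult)

context borel_prob_pair
begin

text \<open>The substitution z = x + v / t fixes the width of the Gaussian and moves the dependence
  on t into the argument of f, where it disappears as t grows.\<close>

lemma integral_against_smooth:
  fixes f :: "real^3 \<Rightarrow> real"
  assumes [measurable]: "f \<in> borel_measurable borel" and t: "t > 0"
  shows "(\<integral>\<^sup>+z. ennreal (f z) * smooth t \<mu> z \<partial>lborel)
    = ennreal ((1 / t)^3) * (\<integral>\<^sup>+x. \<integral>\<^sup>+v. ennreal (f (x + (1 / t) *\<^sub>R v)) * ennreal (exp (- (2 * (norm v)^2))) \<partial>lborel \<partial>\<mu>)"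
proof -
  have "(\<integral>\<^sup>+z. ennreal (f z) * smooth t \<mu> z \<partial>lborel)
     = (\<integral>\<^sup>+z. \<integral>\<^sup>+x. ennreal (f z) * ennreal (exp (- (2 * t^2 * (norm (x - z))^2))) \<partial>\<mu> \<partial>lborel)"
    unfolding smooth_def by (simp add: nn_integral_cmult)
  also have "\<dots> = (\<integral>\<^sup>+x. \<integral>\<^sup>+z. ennreal (f z) * ennreal (exp (- (2 * t^2 * (norm (x - z))^2))) \<partial>lborel \<partial>\<mu>)"
    by (rule LM.Fubini'[symmetric]) measurable
  also have "\<dots> = (\<integral>\<^sup>+x. ennreal ((1 / t)^3) * (\<integral>\<^sup>+v. ennreal (f (x + (1 / t) *\<^sub>R v)) * ennreal (exp (- (2 * (norm v)^2))) \<partial>lborel) \<partial>\<mu>)"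
  proof (rule nn_integral_cong)
    fix x
    have "(\<integral>\<^sup>+z. ennreal (f z) * ennreal (exp (- (2 * t^2 * (norm (x - z))^2))) \<partial>lborel)
      = (\<integral>\<^sup>+z. ennreal (f (x + z)) * ennreal (exp (- (2 * t^2 * (norm (x - (x + z)))^2))) \<partial>lborel)"
      by (rule nn_integral_lborel_translate[symmetric]) measurable
    also have "\<dots> = ennreal (\<bar>1 / t\<bar>^3) * (\<integral>\<^sup>+v. ennreal (f (x + (1 / t) *\<^sub>R v)) * ennreal (exp (- (2 * t^2 * (norm (x - (x + (1 / t) *\<^sub>R v)))^2))) \<partial>lborel)"
      by (rule nn_integral_lborel_scale) (use t in simp_all)
    also have "\<dots> = ennreal ((1 / t)^3) * (\<integral>\<^sup>+v. ennreal (f (x + (1 / t) *\<^sub>R v)) * ennreal (exp (- (2 * (norm v)^2))) \<partial>lborel)"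
    proof -
      have "2 * t^2 * (norm (x - (x + (1 / t) *\<^sub>R v)))^2 = 2 * (norm v)^2" for v
        using t by (simp add: power_divide)
      then show ?thesis using t by (simp only:) simp
    qed
    finally show "(\<integral>\<^sup>+z. ennreal (f z) * ennreal (exp (- (2 * t^2 * (norm (x - z))^2))) \<partial>lborel) = \<dots>" .
  qed
  also have "\<dots> = ennreal ((1 / t)^3) * (\<integral>\<^sup>+x. \<integral>\<^sup>+v. ennreal (f (x + (1 / t) *\<^sub>R v)) * ennreal (exp (- (2 * (norm v)^2))) \<partial>lborel \<partial>\<mu>)"
    by (rule nn_integral_cmult) measurable
  finally show ?thesis .
qed

text \<open>Dominated convergence twice: since f \<le> 1, the Gaussian dominates the inner integrand
  and its finite mass dominates the outer one.\<close>

lemma smoothing_tendsto: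
  fixes f :: "real^3 \<Rightarrow> real"
  assumes f: "continuous_on UNIV f" "\<And>x. 0 \<le> f x" "\<And>x. f x \<le> 1" and s: "s \<longlonglongrightarrow> (0::real)"
  shows "(\<lambda>n. \<integral>\<^sup>+x. \<integral>\<^sup>+v. ennreal (f (x + s n *\<^sub>R v)) * ennreal (exp (- (2 * (norm v)^2))) \<partial>lborel \<partial>\<mu>)
    \<longlonglongrightarrow> (\<integral>\<^sup>+x. ennreal (f x) \<partial>\<mu>) * (\<integral>\<^sup>+v. ennreal (exp (- (2 * (norm v)^2))) \<partial>(lborel :: (real^3) measure))"
proof -
  have [measurable]: "f \<in> borel_measurable borel" using f(1) by (rule borel_measurable_continuous_onI)
  define K where "K = (\<integral>\<^sup>+v. ennreal (exp (- (2 * (norm v)^2))) \<partial>(lborel :: (real^3) measure))"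
  have K: "K < \<infinity>" unfolding K_def using nn_integral_gaussian_finite_pos[of 2] by simp
  have b: "ennreal (f y) * ennreal (exp (- (2 * (norm v)^2))) \<le> ennreal (exp (- (2 * (norm v)^2)))" for y v :: "real^3"
    using f(2,3)[of y] by (simp flip: ennreal_mult add: mult_left_le_one_le)
  have "(\<lambda>n. \<integral>\<^sup>+x. \<integral>\<^sup>+v. ennreal (f (x + s n *\<^sub>R v)) * ennreal (exp (- (2 * (norm v)^2))) \<partial>lborel \<partial>\<mu>)
    \<longlonglongrightarrow> (\<integral>\<^sup>+x. \<integral>\<^sup>+v. ennreal (f x) * ennreal (exp (- (2 * (norm (v :: real^3))^2))) \<partial>lborel \<partial>\<mu>)"
  proof (rule nn_integral_dominated_convergence[where w = "\<lambda>_. K"])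
    show "AE x in \<mu>. (\<lambda>n. \<integral>\<^sup>+v. ennreal (f (x + s n *\<^sub>R v)) * ennreal (exp (- (2 * (norm v)^2))) \<partial>lborel)
        \<longlonglongrightarrow> (\<integral>\<^sup>+v. ennreal (f x) * ennreal (exp (- (2 * (norm (v :: real^3))^2))) \<partial>lborel)"
    proof (rule AE_I2, rule nn_integral_dominated_convergence[where w = "\<lambda>v. ennreal (exp (- (2 * (norm v)^2)))"])
      fix x :: "real^3"
      show "AE v in lborel. (\<lambda>n. ennreal (f (x + s n *\<^sub>R v)) * ennreal (exp (- (2 * (norm v)^2))))
        \<longlonglongrightarrow> ennreal (f x) * ennreal (exp (- (2 * (norm v)^2)))"
      proof (rule AE_I2)
        fix v :: "real^3"
        have "(\<lambda>n. x + s n *\<^sub>R v) \<longlonglongrightarrow> x + 0 *\<^sub>R v" by (intro tendsto_intros s)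
        moreover have "isCont f (x + 0 *\<^sub>R v)" using f(1) by (simp add: continuous_on_eq_continuous_at)
        ultimately have "(\<lambda>n. f (x + s n *\<^sub>R v)) \<longlonglongrightarrow> f (x + 0 *\<^sub>R v)" by (rule isCont_tendsto_compose[rotated])
        then have "(\<lambda>n. ennreal (f (x + s n *\<^sub>R v) * exp (- (2 * (norm v)^2)))) \<longlonglongrightarrow> ennreal (f x * exp (- (2 * (norm v)^2)))"
          by (intro tendsto_intros) simp
        then show "(\<lambda>n. ennreal (f (x + s n *\<^sub>R v)) * ennreal (exp (- (2 * (norm v)^2))))
        \<longlonglongrightarrow> ennreal (f x) * ennreal (exp (- (2 * (norm v)^2)))"
          using f(2) by (simp add: ennreal_mult)
      qed
    qed (use b K in \<open>auto simp: K_def\<close>)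
    show "\<And>n. AE x in \<mu>. (\<integral>\<^sup>+v. ennreal (f (x + s n *\<^sub>R v)) * ennreal (exp (- (2 * (norm v)^2))) \<partial>lborel) \<le> K"
      unfolding K_def using b by (intro AE_I2 nn_integral_mono) 
    show "(\<integral>\<^sup>+x. K \<partial>\<mu>) < \<infinity>" using K by (simp add: M.emeasure_space_1[simplified])
  qed measurable
  then show ?thesis by (simp add: nn_integral_cmult nn_integral_multc)
qed

text \<open>Closed sets generate the Borel sets and are stable under intersection, and the indicator
  of a closed set is a pointwise limit of continuous functions with values in [0, 1].\<close>

lemma eq_if_nn_integral_continuous_eq:
  assumes eq: "\<And>f. continuous_on UNIV f \<Longrightarrow> (\<And>x. 0 \<le> f x) \<Longrightarrow> (\<And>x. f x \<le> 1) \<Longrightarrow>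
     (\<integral>\<^sup>+x. ennreal (f x) \<partial>\<mu>) = (\<integral>\<^sup>+x. ennreal (f x) \<partial>\<nu>)"
  shows "\<mu> = \<nu>"
proof (rule measure_eqI_generator_eq[where E = "Collect closed" and \<Omega> = UNIV and A = "\<lambda>_. UNIV"])
  show "Int_stable (Collect (closed :: (real^3) set \<Rightarrow> bool))" by (auto simp: Int_stable_def)
  show "sets \<mu> = sigma_sets UNIV (Collect closed)" "sets \<nu> = sigma_sets UNIV (Collect closed)"
    by (simp_all add: sets_M sets_N borel_eq_closed)
  fix C :: "(real^3) set" assume "C \<in> Collect closed"
  then have C: "closed C" by simp
  show "emeasure \<mu> C = emeasure \<nu> C"
  proof (cases "C = {}")
    case False
    \<comment> \<open>Tents that fall from 1 on C to 0 at distance 1/n. The empty set is treated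
      apart because the distance to it is 0 by convention.\<close>
    define f where "f n x = max 0 (1 - real n * infdist x C)" for n and x :: "real^3"
    have cont: "continuous_on UNIV (f n)" for n
      unfolding f_def by (intro continuous_intros)
    then have [measurable]: "f n \<in> borel_measurable borel" for n by (rule borel_measurable_continuous_onI)
    have f01: "0 \<le> f n x" "f n x \<le> 1" for n x by (auto simp: f_def infdist_nonneg)
    have [measurable]: "C \<in> sets borel" using C by simp
    have lim: "(\<lambda>n. ennreal (f n x)) \<longlonglongrightarrow> indicator C x" for x
    proof (cases "x \<in> C")
      case True
      then show ?thesis by (simp add: f_def)
    next
      case x: False
      then have pos: "infdist x C > 0" using C False in_closed_iff_infdist_zero infdist_nonneg[of x C] by (metis less_eq_real_def)
      obtain N where N: "real N * infdist x C > 1" using reals_Archimedean3[OF pos] by blast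
      have "\<forall>\<^sub>F n in sequentially. ennreal (f n x) = indicator C x"
        using eventually_ge_at_top[of N]
      proof eventually_elim
        case (elim n)
        then have "real n * infdist x C \<ge> real N * infdist x C" using pos by (intro mult_right_mono) auto
        then show ?case using N x by (simp add: f_def)
      qed
      then show ?thesis by (rule tendsto_eventually)
    qed
    have "(\<lambda>n. \<integral>\<^sup>+x. ennreal (f n x) \<partial>\<mu>) \<longlonglongrightarrow> (\<integral>\<^sup>+x. indicator C x \<partial>\<mu>)"
      by (rule nn_integral_dominated_convergence[where w = "\<lambda>_. 1"])
         (use lim f01 in \<open>auto simp: M.emeasure_space_1[simplified] ennreal_le_1\<close>)
    moreover have "(\<lambda>n. \<integral>\<^sup>+x. ennreal (f n x) \<partial>\<nu>) \<longlonglongrightarrow> (\<integral>\<^sup>+x. indicator C x \<partial>\<nu>)"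
      by (rule nn_integral_dominated_convergence[where w = "\<lambda>_. 1"])
         (use lim f01 in \<open>auto simp: N.emeasure_space_1[simplified] ennreal_le_1\<close>)
    ultimately have "(\<integral>\<^sup>+x. indicator C x \<partial>\<mu>) = (\<integral>\<^sup>+x. indicator C x \<partial>\<nu>)"
      using eq[OF cont f01] LIMSEQ_unique by simp
    then show ?thesis by simp
  qed simp
qed (auto simp: M.emeasure_space_1[simplified])

text \<open>Every interval [n + 1, n + 2] has positive length and so contains a parameter at which
  the mollifications agree almost everywhere. Along such parameters tending to infinity, integrals
  of continuous test functions are recovered.\<close>

lemma eq_if_smooth_dist_0:
  assumes AE: "AE t in lborel. t > 0 \<longrightarrow> smooth_dist t \<mu> \<nu> = 0"
  shows "\<mu> = \<nu>"
proof (rule eq_if_nn_integral_continuous_eq)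
  fix f :: "real^3 \<Rightarrow> real"
  assume f: "continuous_on UNIV f" "\<And>x. 0 \<le> f x" "\<And>x. f x \<le> 1"
  have [measurable]: "f \<in> borel_measurable borel" using f(1) by (rule borel_measurable_continuous_onI)
  have "\<exists>t. real (Suc n) \<le> t \<and> smooth_dist t \<mu> \<nu> = 0" for n
  proof (rule ccontr)
    assume n: "\<nexists>t. real (Suc n) \<le> t \<and> smooth_dist t \<mu> \<nu> = 0"
    have "AE t in lborel. t \<notin> {real (Suc n)..real (Suc n) + 1}"
      using AE by eventually_elim (use n in force)
    then have "emeasure lborel {real (Suc n)..real (Suc n) + 1} = 0"
      by (subst (asm) AE_iff_null_sets[symmetric]) auto
    then show False by simp
  qed
  then obtain t where t: "\<And>n. real (Suc n) \<le> t n" "\<And>n. smooth_dist (t n) \<mu> \<nu> = 0" by metis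
  have tpos: "t n > 0" for n using t(1)[of n] by linarith
  have t0: "(\<lambda>n. 1 / t n) \<longlonglongrightarrow> 0"
  proof (rule tendsto_sandwich[OF _ _ tendsto_const LIMSEQ_inverse_real_of_nat])
    show "\<forall>\<^sub>F n in sequentially. 1 / t n \<le> inverse (real (Suc n))"
      using t(1) tpos by (auto simp: field_simps)
  qed (use tpos in \<open>auto intro!: always_eventually less_imp_le\<close>)
  have step: "(\<integral>\<^sup>+x. \<integral>\<^sup>+v. ennreal (f (x + (1 / t n) *\<^sub>R v)) * ennreal (exp (- (2 * (norm v)^2))) \<partial>lborel \<partial>\<mu>)
     = (\<integral>\<^sup>+x. \<integral>\<^sup>+v. ennreal (f (x + (1 / t n) *\<^sub>R v)) * ennreal (exp (- (2 * (norm v)^2))) \<partial>lborel \<partial>\<nu>)" (is "?A = ?B") for n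
  proof -
    have "AE z in lborel. ennreal ((enn2real (smooth (t n) \<mu> z) - enn2real (smooth (t n) \<nu> z))^2) = 0"
      using t(2)[of n] unfolding smooth_dist_def by (subst (asm) nn_integral_0_iff_AE) measurable
    then have "AE z in lborel. smooth (t n) \<mu> z = smooth (t n) \<nu> z"
    proof eventually_elim
      case (elim z)
      then have "enn2real (smooth (t n) \<mu> z) = enn2real (smooth (t n) \<nu> z)" by (simp add: ennreal_eq_0_iff)
      moreover have "smooth (t n) \<mu> z < \<top>" "smooth (t n) \<nu> z < \<top>"
        using smooth_le_1[of "t n" z] by (auto intro: le_less_trans)
      ultimately show ?case by (metis ennreal_enn2real)
    qed
    then have "(\<integral>\<^sup>+z. ennreal (f z) * smooth (t n) \<mu> z \<partial>lborel) = (\<integral>\<^sup>+z. ennreal (f z) * smooth (t n) \<nu> z \<partial>lborel)"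
      by (rule nn_integral_cong_AE[OF eventually_mono]) simp
    then have "ennreal ((1 / t n)^3) * ?A = ennreal ((1 / t n)^3) * ?B"
      using integral_against_smooth[of f "t n"] borel_prob_pair.integral_against_smooth[OF swapped(1), of f "t n"] tpos by simp
    then show ?thesis
      using tpos[of n] by (subst (asm) ennreal_mult_cancel_left) (auto simp: ennreal_eq_0_iff not_le)
  qed
  let ?K = "\<integral>\<^sup>+v. ennreal (exp (- (2 * (norm v)^2))) \<partial>(lborel :: (real^3) measure)"
  have "(\<integral>\<^sup>+x. ennreal (f x) \<partial>\<mu>) * ?K = (\<integral>\<^sup>+x. ennreal (f x) \<partial>\<nu>) * ?K"
    using smoothing_tendsto[OF f t0] borel_prob_pair.smoothing_tendsto[OF swapped(1) f t0]
    unfolding step by (rule LIMSEQ_unique)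
  then have "?K * (\<integral>\<^sup>+x. ennreal (f x) \<partial>\<mu>) = ?K * (\<integral>\<^sup>+x. ennreal (f x) \<partial>\<nu>)"
    by (simp only: mult.commute)
  then show "(\<integral>\<^sup>+x. ennreal (f x) \<partial>\<mu>) = (\<integral>\<^sup>+x. ennreal (f x) \<partial>\<nu>)"
    using nn_integral_gaussian_finite_pos[of 2] by (subst (asm) ennreal_mult_cancel_left) auto
qed

end

section \<open>The potential of the radial density\<close>

context radial_profile
begin

definition dens :: "real^3 \<Rightarrow> real" where
  "dens x = u (norm x) / norm x * indicator {..R} (norm x)"

lemma dens_measurable [measurable]: "dens \<in> borel_measurable borel"
  unfolding dens_def[abs_def] by measurable

lemma dens_nonneg: "dens x \<ge> 0"
  unfolding dens_def by (auto split: split_indicator intro!: divide_nonneg_nonneg nonneg)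

text \<open>Here \<open>\<Phi> s\<close> accumulates w over the squared distances from x to the
  sphere of radius s. The value s = r is left out because there the range of b reaches 0, where w
  may be singular. The substitution a = s^2 turns the weight u(sqrt a) / sqrt a into 2 u(s).\<close>

lemma radial_convolution:
  fixes x :: "real^3" and \<Phi> :: "real \<Rightarrow> real" and w :: "real \<Rightarrow> ennreal"
  assumes w [measurable]: "w \<in> borel_measurable borel" and \<Phi> [measurable]: "\<Phi> \<in> borel_measurable borel"
    and x: "x \<noteq> 0" and r: "r = norm x"
    and I: "\<And>s. 0 < s \<Longrightarrow> s \<noteq> r \<Longrightarrow> (\<integral>\<^sup>+b. w b * indicator {(s - r)^2..(s + r)^2} b \<partial>lborel) = ennreal (\<Phi> s)"
    and \<Phi>_nonneg: "\<And>s. 0 \<le> s \<Longrightarrow> \<Phi> s \<ge> 0"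
  shows "(\<integral>\<^sup>+y. w ((norm (x - y))^2) * ennreal (dens y) \<partial>lborel)
    = ennreal (pi / r) * (\<integral>\<^sup>+s. ennreal (u s * \<Phi> s) * indicator {0..R} s \<partial>lborel)"
proof -
  have r0: "r > 0" using x r by simp
  define H where "H a b = w b * ennreal (u (sqrt a) / sqrt a * indicator {..R} (sqrt a))" for a b
  define f where "f a = pi / (2 * r) * (u (sqrt a) / sqrt a * \<Phi> (sqrt a))" for a
  have [measurable]: "f \<in> borel_measurable borel" unfolding f_def[abs_def] by measurable
  have Hm: "case_prod H \<in> borel_measurable borel"
    unfolding H_def[abs_def] borel_prod[symmetric] by measurable
  have "(\<integral>\<^sup>+y. w ((norm (x - y))^2) * ennreal (dens y) \<partial>lborel) = (\<integral>\<^sup>+y. H ((norm y)^2) ((norm (x - y))^2) \<partial>lborel)"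
    by (simp add: H_def dens_def)
  also have "\<dots> = (\<integral>\<^sup>+a. indicator {0..} a * (ennreal (pi / (2 * r)) *
      (\<integral>\<^sup>+b. H a b * indicator {(sqrt a - r)^2..(sqrt a + r)^2} b \<partial>lborel)) \<partial>lborel)"
    unfolding r by (rule nn_integral_bipolar[OF Hm x])
  also have "\<dots> = (\<integral>\<^sup>+a. ennreal (f a * indicator {0^2..R^2} a) \<partial>lborel)"
  proof (rule nn_integral_cong_AE)
    show "AE a in lborel. indicator {0..} a * (ennreal (pi / (2 * r)) *
      (\<integral>\<^sup>+b. H a b * indicator {(sqrt a - r)^2..(sqrt a + r)^2} b \<partial>lborel)) = ennreal (f a * indicator {0^2..R^2} a)"
      using AE_lborel_singleton[of 0] AE_lborel_singleton[of "r^2"]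
    proof eventually_elim
      case (elim a)
      show ?case
      proof (cases "a > 0")
        case True
        have ne: "sqrt a \<noteq> r" using elim True by auto
        have "(\<integral>\<^sup>+b. H a b * indicator {(sqrt a - r)^2..(sqrt a + r)^2} b \<partial>lborel)
          = ennreal (u (sqrt a) / sqrt a * indicator {..R} (sqrt a)) * (\<integral>\<^sup>+b. w b * indicator {(sqrt a - r)^2..(sqrt a + r)^2} b \<partial>lborel)"
          unfolding H_def by (subst nn_integral_cmult[symmetric]) (auto simp: mult_ac)
        also have "\<dots> = ennreal (u (sqrt a) / sqrt a * indicator {..R} (sqrt a)) * ennreal (\<Phi> (sqrt a))"
          using True ne by (subst I) auto
        finally have eq: "(\<integral>\<^sup>+b. H a b * indicator {(sqrt a - r)^2..(sqrt a + r)^2} b \<partial>lborel) = \<dots>" .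
        have iff: "sqrt a \<le> R \<longleftrightarrow> a \<le> R^2" using True R_pos real_sqrt_le_iff[of a "R^2"] by simp
        show ?thesis
        proof (cases "a \<le> R^2")
          case le: True
          have "u (sqrt a) \<ge> 0" using le iff True by (intro nonneg) auto
          then have "ennreal (pi / (2 * r)) * (ennreal (u (sqrt a) / sqrt a) * ennreal (\<Phi> (sqrt a))) = ennreal (f a)"
            unfolding f_def using r0 True \<Phi>_nonneg[of "sqrt a"] 
            by (subst ennreal_mult[symmetric], simp, simp)+ simp
          then show ?thesis using le iff True unfolding eq by simp
        next
          case False
          then show ?thesis using iff True unfolding eq by simp
        qed
      qed (use elim in auto)
    qed
  qed
  also have "\<dots> = (\<integral>\<^sup>+s. ennreal (f (s^2) * (2 * s) * indicator {0..R} s) \<partial>lborel)"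
    using R_pos
    by (intro nn_integral_substitution)
       (auto simp: set_borel_measurable_def intro!: derivative_eq_intros continuous_intros)
  also have "\<dots> = (\<integral>\<^sup>+s. ennreal (pi / r) * (ennreal (u s * \<Phi> s) * indicator {0..R} s) \<partial>lborel)"
  proof (rule nn_integral_cong_AE)
    show "AE s in lborel. ennreal (f (s^2) * (2 * s) * indicator {0..R} s) = ennreal (pi / r) * (ennreal (u s * \<Phi> s) * indicator {0..R} s)"
      using AE_lborel_singleton[of 0]
    proof eventually_elim
      case (elim s)
      show ?case
      proof (cases "0 < s \<and> s \<le> R")
        case True
        then have "f (s^2) * (2 * s) = pi / r * (u s * \<Phi> s)" using r0 by (simp add: f_def field_simps)
        moreover have "0 \<le> u s * \<Phi> s" using True nonneg \<Phi>_nonneg by simp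
        moreover have "ennreal (pi / r * (u s * \<Phi> s)) = ennreal (pi / r) * ennreal (u s * \<Phi> s)"
          using calculation(2) r0 by (intro ennreal_mult) auto
        ultimately show ?thesis using True by simp
      qed (use elim in \<open>auto split: split_indicator\<close>)
    qed
  qed
  also have "\<dots> = ennreal (pi / r) * (\<integral>\<^sup>+s. ennreal (u s * \<Phi> s) * indicator {0..R} s \<partial>lborel)"
    by (rule nn_integral_cmult) measurable
  finally show ?thesis .
qed

text \<open>The mass is obtained from the same convolution formula with w = 1, seen from an
  arbitrary nonzero point; its distance r cancels.\<close>

lemma nn_integral_dens: "(\<integral>\<^sup>+y. ennreal (dens y) \<partial>lborel) = ennreal (pi * u2 R / 2)"
proof -
  define x :: "real^3" where "x = axis 1 1"
  have x: "x \<noteq> 0" by (simp add: x_def axis_eq_0_iff)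
  define r where "r = norm x"
  have r: "r > 0" using x by (simp add: r_def)
  have "(\<integral>\<^sup>+y. (\<lambda>_. 1) ((norm (x - y))^2) * ennreal (dens y) \<partial>lborel)
    = ennreal (pi / r) * (\<integral>\<^sup>+s. ennreal (u s * (4 * r * s)) * indicator {0..R} s \<partial>lborel)"
  proof (rule radial_convolution[OF _ _ x r_def])
    fix s :: real assume s: "0 < s"
    have "(s - r)^2 \<le> (s + r)^2" using s r by (simp add: power2_sum power2_diff)
    moreover have "(s + r)^2 - (s - r)^2 = 4 * r * s" by (simp add: power2_sum power2_diff)
    ultimately show "(\<integral>\<^sup>+b. 1 * indicator {(s - r)^2..(s + r)^2} b \<partial>lborel) = ennreal (4 * r * s)"
      by simp
  qed (use r in auto)
  also have "(\<integral>\<^sup>+s. ennreal (u s * (4 * r * s)) * indicator {0..R} s \<partial>lborel)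
     = (\<integral>\<^sup>+s. ennreal (4 * r) * (ennreal (u s * s) * indicator {0..R} s) \<partial>lborel)"
    using r nonneg by (intro nn_integral_cong) (auto simp: mult_ac simp flip: ennreal_mult split: split_indicator)
  also have "\<dots> = ennreal (4 * r) * ennreal (u2 R / 8)"
    by (subst nn_integral_cmult) (simp_all add: nn_integral_profile_mass)
  also have "ennreal (pi / r) * \<dots> = ennreal (pi * u2 R / 2)"
    using r at_R(3) by (simp flip: ennreal_mult)
  finally show ?thesis by simp
qed

lemma potential_eq:
  fixes x :: "real^3"
  assumes x: "x \<noteq> 0"
  shows "(\<integral>\<^sup>+y. W (x - y) * ennreal (dens y) \<partial>lborel) = ennreal (2 * pi / norm x) *
    (\<integral>\<^sup>+s. ennreal (u s * (kernel1 (s + norm x) - kernel1 \<bar>norm x - s\<bar>)) * indicator {0..R} s \<partial>lborel)"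
proof -
  define r where "r = norm x"
  have r: "r > 0" using x by (simp add: r_def)
  define w where "w b = (if b = 0 then \<infinity> else ennreal (sqrt b ^ 3 / 3 + 1 / sqrt b))" for b :: real
  have Ww: "W z = w ((norm z)^2)" for z by (simp add: W_def w_def)
  have [measurable]: "w \<in> borel_measurable borel" unfolding w_def[abs_def] by measurable
  have mono: "kernel1 \<bar>r - s\<bar> \<le> kernel1 (s + r)" if "0 \<le> s" for s
    using that r by (intro kernel1_mono) auto
  have "(\<integral>\<^sup>+y. w ((norm (x - y))^2) * ennreal (dens y) \<partial>lborel)
    = ennreal (pi / r) * (\<integral>\<^sup>+s. ennreal (u s * (2 * (kernel1 (s + r) - kernel1 \<bar>r - s\<bar>))) * indicator {0..R} s \<partial>lborel)"
  proof (rule radial_convolution[OF _ _ x r_def])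
    fix s :: real assume s: "0 < s" "s \<noteq> r"
    \<comment> \<open>For s different from r the interval of integration stays away from the
      singularity of w at 0.\<close>
    have lo: "(s - r)^2 > 0" using s by simp
    have le: "(s - r)^2 \<le> (s + r)^2" using s r by (simp add: power2_sum power2_diff)
    have "(\<integral>\<^sup>+b. w b * indicator {(s - r)^2..(s + r)^2} b \<partial>lborel)
      = (\<integral>\<^sup>+b. ennreal (sqrt b ^ 3 / 3 + 1 / sqrt b) * indicator {(s - r)^2..(s + r)^2} b \<partial>lborel)"
      using lo by (intro nn_integral_cong) (auto simp: w_def split: split_indicator)
    also have "\<dots> = ennreal (2 * kernel1 (sqrt ((s + r)^2)) - 2 * kernel1 (sqrt ((s - r)^2)))"
    \<comment> \<open>With q = sqrt b one has db = 2 q dq, so integrating W in b amounts to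
      integrating 2 q (q^3 / 3 + 1 / q) in q.\<close>
    proof (rule nn_integral_FTC_Icc[where F = "\<lambda>b. 2 * kernel1 (sqrt b)"])
      fix b assume "b \<in> {(s - r)^2..(s + r)^2}"
      then have b: "b > 0" using less_le_trans[OF lo] by simp
      then have "((\<lambda>b. 2 * kernel1 (sqrt b)) has_real_derivative 2 * (5 * sqrt b ^ 4 / 15 + 1) * (inverse (sqrt b) / 2)) (at b)"
        unfolding kernel1_def by (auto intro!: derivative_eq_intros simp: field_simps)
      moreover have "2 * (5 * sqrt b ^ 4 / 15 + 1) * (inverse (sqrt b) / 2) = sqrt b ^ 3 / 3 + 1 / sqrt b"
      proof -
        have "sqrt b > 0" using b by simp
        then show ?thesis by (simp add: divide_simps eval_nat_numeral)
      qed
      ultimately show "((\<lambda>b. 2 * kernel1 (sqrt b)) has_real_derivative sqrt b ^ 3 / 3 + 1 / sqrt b) (at b)"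
        by (rule DERIV_cong)
      show "0 \<le> sqrt b ^ 3 / 3 + 1 / sqrt b" using b by simp
    qed (use le in auto)
    also have "\<dots> = ennreal (2 * (kernel1 (s + r) - kernel1 \<bar>r - s\<bar>))"
      using s r by (simp add: abs_minus_commute algebra_simps)
    finally show "(\<integral>\<^sup>+b. w b * indicator {(s - r)^2..(s + r)^2} b \<partial>lborel) = \<dots>" .
  qed (use mono in auto)
  also have "(\<integral>\<^sup>+s. ennreal (u s * (2 * (kernel1 (s + r) - kernel1 \<bar>r - s\<bar>))) * indicator {0..R} s \<partial>lborel)
    = (\<integral>\<^sup>+s. 2 * (ennreal (u s * (kernel1 (s + r) - kernel1 \<bar>r - s\<bar>)) * indicator {0..R} s) \<partial>lborel)"
  proof (rule nn_integral_cong)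
    fix s
    have "ennreal (u s * (2 * (kernel1 (s + r) - kernel1 \<bar>r - s\<bar>))) = 2 * ennreal (u s * (kernel1 (s + r) - kernel1 \<bar>r - s\<bar>))"
      if "0 \<le> s" "s \<le> R"
    proof -
      have "0 \<le> u s * (kernel1 (s + r) - kernel1 \<bar>r - s\<bar>)" using nonneg mono that by simp
      then have "ennreal (2 * (u s * (kernel1 (s + r) - kernel1 \<bar>r - s\<bar>))) = 2 * ennreal (u s * (kernel1 (s + r) - kernel1 \<bar>r - s\<bar>))"
        by (subst ennreal_mult) auto
      then show ?thesis by (simp only: mult_ac)
    qed
    then show "ennreal (u s * (2 * (kernel1 (s + r) - kernel1 \<bar>r - s\<bar>))) * indicator {0..R} s
       = 2 * (ennreal (u s * (kernel1 (s + r) - kernel1 \<bar>r - s\<bar>)) * indicator {0..R} s)"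
      by (simp split: split_indicator)
  qed
  also have "\<dots> = 2 * (\<integral>\<^sup>+s. ennreal (u s * (kernel1 (s + r) - kernel1 \<bar>r - s\<bar>)) * indicator {0..R} s \<partial>lborel)"
    by (rule nn_integral_cmult) measurable
  also have "ennreal (pi / r) * \<dots> = ennreal (2 * pi / r) * (\<integral>\<^sup>+s. ennreal (u s * (kernel1 (s + r) - kernel1 \<bar>r - s\<bar>)) * indicator {0..R} s \<partial>lborel)"
  proof -
    have "ennreal (2 * pi / r) = ennreal (pi / r) * 2" using ennreal_mult[of "pi / r" 2] r by (simp add: mult.commute)
    then show ?thesis by (simp only: mult.assoc)
  qed
  finally show ?thesis unfolding Ww r_def .
qed

lemma potential_inside:
  assumes "x \<noteq> 0" "norm x \<le> R"
  shows "(\<integral>\<^sup>+y. W (x - y) * ennreal (dens y) \<partial>lborel) = ennreal (2 * pi * lam)"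
  using assms nn_integral_profile_inside[of "norm x"] unfolding potential_eq[OF assms(1)]
  by (simp add: mult.assoc flip: ennreal_mult)

lemma potential_ge:
  assumes x: "x \<noteq> 0"
  shows "(\<integral>\<^sup>+y. W (x - y) * ennreal (dens y) \<partial>lborel) \<ge> ennreal (2 * pi * lam)"
proof (cases "norm x \<le> R")
  case True
  then show ?thesis using potential_inside[OF x] by simp
next
  case False
  \<comment> \<open>The sign of \<open>lam\<close> is not clear from its formula; it follows from
    evaluating a nonnegative integral at r = R.\<close>
  have "0 \<le> R * lam" using nn_integral_profile_inside(2)[of R] R_pos by simp
  then have "lam \<ge> 0" using R_pos by (simp add: zero_le_mult_iff)
  then have "ennreal (2 * pi * lam) = ennreal (2 * pi / norm x) * ennreal (norm x * lam)"
    using x by (simp flip: ennreal_mult)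
  also have "\<dots> \<le> (\<integral>\<^sup>+y. W (x - y) * ennreal (dens y) \<partial>lborel)"
    unfolding potential_eq[OF x] using False by (intro mult_left_mono nn_integral_profile_outside) auto
  finally show ?thesis .
qed

end

section \<open>Minimizers\<close>

lemma translate_borel_prob: assumes "borel_prob \<nu>" shows "borel_prob (translate a \<nu>)"
proof -
  have [measurable_cong]: "sets \<nu> = sets borel" using assms by (simp add: borel_prob_def)
  show ?thesis using assms unfolding borel_prob_def translate_def
    by (auto intro!: prob_space.prob_space_distr)
qed

lemma translate_translate:
  assumes "borel_prob \<nu>" shows "translate a (translate b \<nu>) = translate (a + b) \<nu>"
proof -
  have [measurable_cong]: "sets \<nu> = sets borel" using assms by (simp add: borel_prob_def)
  show ?thesis unfolding translate_def by (subst distr_distr) (auto simp: comp_def ac_simps)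
qed

lemma translate_0: assumes "borel_prob \<nu>" shows "translate 0 \<nu> = \<nu>"
  using assms unfolding translate_def borel_prob_def by (simp add: distr_id2)

lemma interaction_translate:
  assumes "borel_prob \<nu>" shows "interaction (translate a \<nu>) (translate a \<nu>) = interaction \<nu> \<nu>"
proof -
  interpret borel_prob_pair \<nu> \<nu> using assms by (simp add: borel_prob_pair_def)
  show ?thesis unfolding interaction_def translate_def by (simp add: nn_integral_distr)
qed

text \<open>Finite interaction yields one point x with finite potential, and W grows faster than the
  square of the distance to x.\<close>

lemma finite_interaction_integrable:
  assumes "borel_prob \<nu>" "interaction \<nu> \<nu> < \<infinity>" shows "integrable \<nu> (\<lambda>x. (norm x)^2)"
proof -
  interpret borel_prob_pair \<nu> \<nu> using assms by (simp add: borel_prob_pair_def)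
  have AE: "AE x in \<nu>. (\<integral>\<^sup>+y. W (x - y) \<partial>\<nu>) \<noteq> \<infinity>"
    using assms(2) unfolding interaction_def by (intro nn_integral_noteq_infinite) auto
  obtain x where x: "(\<integral>\<^sup>+y. W (x - y) \<partial>\<nu>) \<noteq> \<infinity>"
    using eventually_happens'[OF M.ae_filter_bot AE] by blast
  \<comment> \<open>With q = |x - y|: |y|^2 \<le> 2 |x|^2 + 2 q^2 and q^2 \<le> 1 + q^3. The factor
    6 is this 2 times the 3 that compensates q^3 / 3.\<close>
  have "(\<integral>\<^sup>+y. ennreal ((norm y)^2) \<partial>\<nu>) \<le> (\<integral>\<^sup>+y. ennreal (2 * (norm x)^2 + 2) + 6 * W (x - y) \<partial>\<nu>)"
  proof (rule nn_integral_mono)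
    fix y
    show "ennreal ((norm y)^2) \<le> ennreal (2 * (norm x)^2 + 2) + 6 * W (x - y)"
    proof (cases "x = y")
      case False
      define q where "q = norm (x - y)"
      have q: "q > 0" using False by (simp add: q_def)
      have "norm y \<le> norm x + q" unfolding q_def by (metis norm_minus_commute norm_triangle_sub)
      then have "(norm y)^2 \<le> (norm x + q)^2" by (intro power_mono) auto
      also have "\<dots> \<le> 2 * (norm x)^2 + 2 * q^2"
        using sum_squares_bound[of "norm x" q] by (simp add: power2_sum)
      also have "q^2 \<le> 1 + q^3"
      proof (cases "q \<le> 1")
        case True
        then have "q^2 \<le> 1" using q by (simp add: power_le_one)
        then show ?thesis using q by (simp add: add_increasing2)
      next
        case False
        then have "q^2 \<le> q^3" by (intro power_increasing) auto
        then show ?thesis by simp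
      qed
      finally have "(norm y)^2 \<le> (2 * (norm x)^2 + 2) + 6 * (q^3 / 3)" by simp
      also have "\<dots> \<le> (2 * (norm x)^2 + 2) + 6 * (q^3 / 3 + 1 / q)" using q by simp
      finally have "ennreal ((norm y)^2) \<le> ennreal ((2 * (norm x)^2 + 2) + 6 * (q^3 / 3 + 1 / q))"
        by (rule ennreal_leI)
      also have "\<dots> = ennreal (2 * (norm x)^2 + 2) + 6 * W (x - y)"
        using False q ennreal_mult[of 6 "q^3 / 3 + 1 / q"]
        by (subst ennreal_plus) (auto simp: W_def q_def)
      finally show ?thesis .
    qed (simp add: W_def ennreal_mult_eq_top_iff)
  qed
  also have "\<dots> = ennreal (2 * (norm x)^2 + 2) + 6 * (\<integral>\<^sup>+y. W (x - y) \<partial>\<nu>)"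
    by (simp add: nn_integral_add nn_integral_cmult M.emeasure_space_1[simplified])
  also have "\<dots> < \<infinity>" using x by (simp add: ennreal_mult_less_top less_top ennreal_add_less_top)
  finally have "(\<integral>\<^sup>+y. ennreal ((norm y)^2) \<partial>\<nu>) < \<infinity>" .
  then show ?thesis by (intro integrableI_nonneg) auto
qed

text \<open>If the potential at 0 is infinite, 0 lies in the null set where the potential is
  infinite. If it is finite, W(0 - y) is finite for almost every y, which excludes y = 0.\<close>

lemma finite_interaction_no_atom:
  assumes "borel_prob \<nu>" "interaction \<nu> \<nu> < \<infinity>" shows "AE x in \<nu>. x \<noteq> 0"
proof -
  interpret borel_prob_pair \<nu> \<nu> using assms by (simp add: borel_prob_pair_def)
  have AE: "AE x in \<nu>. (\<integral>\<^sup>+y. W (x - y) \<partial>\<nu>) \<noteq> \<infinity>"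
    using assms(2) unfolding interaction_def by (intro nn_integral_noteq_infinite) auto
  show ?thesis
  proof (cases "(\<integral>\<^sup>+y. W (0 - y) \<partial>\<nu>) = \<infinity>")
    case True
    show ?thesis using AE by eventually_elim (use True in auto)
  next
    case False
    then have "AE y in \<nu>. W (0 - y) \<noteq> \<infinity>" by (intro nn_integral_noteq_infinite) auto
    then show ?thesis by eventually_elim (auto simp: W_def)
  qed
qed

lemma recenter:
  assumes "borel_prob \<nu>" "interaction \<nu> \<nu> < \<infinity>"
  obtains m where "centered (translate (- m) \<nu>)" "\<nu> = translate m (translate (- m) \<nu>)"
proof -
  interpret borel_prob_pair \<nu> \<nu> using assms by (simp add: borel_prob_pair_def)
  define m where "m = (\<integral>x. x \<partial>\<nu>)"
  have i2: "integrable \<nu> (\<lambda>x. (norm x)^2)" using finite_interaction_integrable assms .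
  have i1: "integrable \<nu> (\<lambda>x. x)" using integrable_id_of_square assms(1) i2 .
  have bp': "borel_prob (translate (- m) \<nu>)" using translate_borel_prob assms(1) .
  have "interaction (translate (- m) \<nu>) (translate (- m) \<nu>) < \<infinity>"
    using assms by (simp add: interaction_translate)
  then have "integrable (translate (- m) \<nu>) (\<lambda>x. (norm x)^2)" using finite_interaction_integrable bp' by blast
  moreover have "(\<integral>x. x \<partial>translate (- m) \<nu>) = (\<integral>x. x + - m \<partial>\<nu>)"
    unfolding translate_def by (rule integral_distr) measurable
  moreover have "(\<integral>x. x + - m \<partial>\<nu>) = 0"
    using i1 by (simp add: m_def M.prob_space[simplified])
  ultimately have "centered (translate (- m) \<nu>)" using bp' by (simp add: centered_def)
  moreover have "\<nu> = translate m (translate (- m) \<nu>)"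
    using assms(1) by (simp add: translate_translate translate_0)
  ultimately show ?thesis using that by blast
qed

lemma energy_eq: "energy \<mu> = 1 / 2 * interaction \<mu> \<mu>" by (simp add: energy_def interaction_def)

lemma energy_le_iff: "energy \<mu> \<le> energy \<nu> \<longleftrightarrow> interaction \<mu> \<mu> \<le> interaction \<nu> \<nu>"
proof
  assume "energy \<mu> \<le> energy \<nu>"
  then have "2 * energy \<mu> \<le> 2 * energy \<nu>" by (intro mult_left_mono) auto
  moreover have "2 * energy \<rho> = interaction \<rho> \<rho>" for \<rho>
    unfolding energy_eq mult.assoc[symmetric] by (simp add: ennreal_times_divide)
  ultimately show "interaction \<mu> \<mu> \<le> interaction \<nu> \<nu>" by simp
qed (auto simp: energy_eq intro: mult_left_mono)

section \<open>Comparison of competitors with the candidate\<close>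

locale normalized_profile = radial_profile +
  assumes normalized: "pi * u2 R / 2 = 1"
begin

definition \<rho> :: "(real^3) measure" where "\<rho> = density lborel (\<lambda>x. ennreal (dens x))"

lemma rho_borel_prob: "borel_prob \<rho>"
  unfolding borel_prob_def \<rho>_def
  using nn_integral_dens normalized by (auto intro!: prob_spaceI simp: emeasure_density)

lemma interaction_with_rho: 
  assumes "borel_prob \<nu>"
  shows "interaction \<nu> \<rho> = (\<integral>\<^sup>+x. \<integral>\<^sup>+y. W (x - y) * ennreal (dens y) \<partial>lborel \<partial>\<nu>)"
  unfolding interaction_def \<rho>_def by (simp add: nn_integral_density mult.commute)

lemma interaction_rho_ge:
  assumes "borel_prob \<nu>" "AE x in \<nu>. x \<noteq> 0"
  shows "interaction \<nu> \<rho> \<ge> ennreal (2 * pi * lam)"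
proof -
  interpret borel_prob_pair \<nu> \<nu> using assms by (simp add: borel_prob_pair_def)
  have "ennreal (2 * pi * lam) = (\<integral>\<^sup>+x. ennreal (2 * pi * lam) \<partial>\<nu>)" by (simp add: M.emeasure_space_1[simplified])
  also have "\<dots> \<le> interaction \<nu> \<rho>"
    unfolding interaction_with_rho[OF assms(1)]
    by (intro nn_integral_mono_AE) (use assms(2) potential_ge in \<open>auto elim: eventually_mono\<close>)
  finally show ?thesis .
qed

text \<open>At the origin \<open>dens\<close> is 0 through division by zero, so the exceptional
  point of \<open>potential_inside\<close> carries no density.\<close>

lemma AE_rho: "AE x in \<rho>. x \<noteq> 0 \<and> norm x \<le> R"
  unfolding \<rho>_def by (subst AE_density) (auto simp: dens_def split: split_indicator)

lemma interaction_rho: "interaction \<rho> \<rho> = ennreal (2 * pi * lam)"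
proof -
  interpret borel_prob_pair \<rho> \<rho> using rho_borel_prob by (simp add: borel_prob_pair_def)
  have "interaction \<rho> \<rho> = (\<integral>\<^sup>+x. ennreal (2 * pi * lam) \<partial>\<rho>)"
    unfolding interaction_with_rho[OF rho_borel_prob]
    using potential_inside by (intro nn_integral_cong_AE eventually_mono[OF AE_rho]) auto
  then show ?thesis by (simp add: M.emeasure_space_1[simplified])
qed

lemma rho_centered: "centered \<rho>"
proof -
  interpret borel_prob_pair \<rho> \<rho> using rho_borel_prob by (simp add: borel_prob_pair_def)
  have "integrable \<rho> (\<lambda>x. (norm x)^2)"
    using finite_interaction_integrable[OF rho_borel_prob] by (simp add: interaction_rho)
  moreover have "(\<integral>x. x \<partial>\<rho>) = 0"
  proof -
    have eq: "(\<integral>x. x \<partial>\<rho>) = (\<integral>x. dens x *\<^sub>R x \<partial>lborel)"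
      unfolding \<rho>_def by (rule integral_density) (auto simp: dens_nonneg)
    \<comment> \<open>Reflection at the origin preserves Lebesgue measure and the density, so the
      mean equals its own negative.\<close>
    have "(\<integral>x. dens x *\<^sub>R x \<partial>lborel) = (\<integral>x. dens x *\<^sub>R x \<partial>distr lborel borel uminus)"
      by (subst lborel_distr_orthogonal) (simp_all add: orthogonal_transformation linear_uminus)
    also have "\<dots> = (\<integral>x. dens (- x) *\<^sub>R (- x) \<partial>lborel)"
      by (rule integral_distr) measurable
    also have "\<dots> = - (\<integral>x. dens x *\<^sub>R x \<partial>lborel)" by (simp add: dens_def)
    finally show ?thesis unfolding eq by (simp add: eq_neg_iff_add_eq_0 flip: scaleR_2)
  qed
  ultimately show ?thesis using rho_borel_prob by (simp add: centered_def)
qed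

lemma rho_minimal_centered:
  assumes c: "centered \<nu>" and fin: "interaction \<nu> \<nu> < \<infinity>"
  shows "interaction \<rho> \<rho> \<le> interaction \<nu> \<nu>"
    and "interaction \<nu> \<nu> \<le> interaction \<rho> \<rho> \<Longrightarrow> \<nu> = \<rho>"
proof -
  have bp: "borel_prob \<nu>" using c by (rule centered_borel_prob)
  interpret borel_prob_pair \<nu> \<rho> using bp rho_borel_prob by (simp add: borel_prob_pair_def)
  obtain a b where ab: "a > 0" "b > 0" and pol:
    "interaction \<nu> \<nu> + interaction \<rho> \<rho> = 2 * interaction \<nu> \<rho>
      + (\<integral>\<^sup>+t. ennreal (a + b / t^4) * (smooth_dist t \<nu> \<rho> / gauss_mass t) * indicator {0<..} t \<partial>lborel)"
    (is "_ = _ + ?D")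
    using interaction_polarization[OF c rho_centered] by blast
  have "interaction \<nu> \<rho> \<ge> interaction \<rho> \<rho>"
    unfolding interaction_rho by (intro interaction_rho_ge bp finite_interaction_no_atom fin)
  then have "2 * interaction \<rho> \<rho> + ?D \<le> 2 * interaction \<nu> \<rho> + ?D"
    by (intro add_right_mono mult_left_mono) auto
  then have *: "interaction \<rho> \<rho> + (interaction \<rho> \<rho> + ?D) \<le> interaction \<rho> \<rho> + interaction \<nu> \<nu>"
    unfolding pol[symmetric] by (simp only: mult_2 add_ac)
  \<comment> \<open>One copy of the interaction of \<rho> with itself is cancelled; it is finite,
    being the constant value of the potential.\<close>
  have **: "interaction \<rho> \<rho> + ?D \<le> interaction \<nu> \<nu>"
    using * unfolding ennreal_add_left_cancel_le by (simp add: interaction_rho)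
  then show "interaction \<rho> \<rho> \<le> interaction \<nu> \<nu>"
    by (rule order_trans[rotated]) simp
  assume "interaction \<nu> \<nu> \<le> interaction \<rho> \<rho>"
  with ** have "interaction \<rho> \<rho> + ?D \<le> interaction \<rho> \<rho> + 0" unfolding add_0_right by (rule order_trans)
  then have D: "?D = 0" unfolding ennreal_add_left_cancel_le by (simp add: interaction_rho)
  have "AE t in lborel. t > 0 \<longrightarrow> smooth_dist t \<nu> \<rho> = 0"
  proof -
    have "AE t in lborel. ennreal (a + b / t^4) * (smooth_dist t \<nu> \<rho> / gauss_mass t) * indicator {0<..} t = 0"
      using D by (subst (asm) nn_integral_0_iff_AE) measurable
    then show ?thesis
    proof eventually_elim
      case (elim t)
      show ?case
      proof
        assume t: "t > 0"
        then have "a + b / t^4 > 0" using ab by (simp add: add_pos_pos)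
        then show "smooth_dist t \<nu> \<rho> = 0"
          using elim t gauss_mass[OF t] by (auto simp: ennreal_eq_0_iff ennreal_divide_eq_0_iff not_le)
      qed
    qed
  qed
  then show "\<nu> = \<rho>" by (rule eq_if_smooth_dist_0)
qed

lemma rho_minimal: 
  assumes "borel_prob \<nu>"
  shows "interaction \<rho> \<rho> \<le> interaction \<nu> \<nu>"
    and "interaction \<nu> \<nu> \<le> interaction \<rho> \<rho> \<Longrightarrow> \<exists>a. \<nu> = translate a \<rho>"
proof -
  have *: "interaction \<rho> \<rho> \<le> interaction \<nu> \<nu> \<and> (interaction \<nu> \<nu> \<le> interaction \<rho> \<rho> \<longrightarrow> (\<exists>a. \<nu> = translate a \<rho>))"
    if fin: "interaction \<nu> \<nu> < \<infinity>"
  proof -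
    obtain m where m: "centered (translate (- m) \<nu>)" "\<nu> = translate m (translate (- m) \<nu>)"
      using recenter[OF assms fin] .
    have eq: "interaction (translate (- m) \<nu>) (translate (- m) \<nu>) = interaction \<nu> \<nu>"
      using assms by (rule interaction_translate)
    show ?thesis using rho_minimal_centered[OF m(1)] m(2) fin unfolding eq by auto
  qed
  show "interaction \<rho> \<rho> \<le> interaction \<nu> \<nu>"
    using * by (cases "interaction \<nu> \<nu> < \<infinity>") (auto simp: less_top[symmetric])
  show "interaction \<nu> \<nu> \<le> interaction \<rho> \<rho> \<Longrightarrow> \<exists>a. \<nu> = translate a \<rho>"
    using * le_less_trans[of "interaction \<nu> \<nu>" "interaction \<rho> \<rho>" \<infinity>] by (simp add: interaction_rho)
qed

lemma is_minimizer_iff: "is_minimizer \<mu> \<longleftrightarrow> (\<exists>a. \<mu> = translate a \<rho>)"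
proof
  assume "is_minimizer \<mu>"
  then show "\<exists>a. \<mu> = translate a \<rho>"
    using rho_minimal(2)[of \<mu>] rho_borel_prob by (simp add: is_minimizer_def energy_le_iff)
next
  assume "\<exists>a. \<mu> = translate a \<rho>"
  then show "is_minimizer \<mu>"
    using rho_minimal(1) by (auto simp: is_minimizer_def energy_le_iff interaction_translate rho_borel_prob translate_borel_prob)
qed

end

theorem mainTheorem4:
  shows "(\<exists>!R::real. R > 0 \<and> radius_eq R) \<and>
    (\<forall>R::real. R > 0 \<and> radius_eq R \<longrightarrow>
       cos (\<beta> * R) \<noteq> 0 \<and>
       (\<exists>C::real.
          (\<integral>x. rho3 R C x \<partial>lborel) = 1 \<and>
          (\<forall>x. rho3 R C x \<ge> 0) \<and>
          (\<forall>\<mu>. is_minimizer \<mu> \<longleftrightarrow>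
             (\<exists>a. \<mu> = translate a (density lborel (\<lambda>x. ennreal (rho3 R C x)))))))"
proof (intro conjI ex1_radius allI impI)
  fix R :: real assume R: "R > 0 \<and> radius_eq R"
  define k where "k = tan (\<beta> * R) * tanh (\<beta> * R)"
  note bc = boundary_conditions[OF conjunct1[OF R] conjunct2[OF R], folded k_def]
  \<comment> \<open>This guarantees that the tangent in the density is not a default value from
    division by zero.\<close>
  show "cos (\<beta> * R) \<noteq> 0" using bc(1) by simp
  \<comment> \<open>The mass of the profile is pi / 2 times its second derivative at R, that is pi C
    \<open>U2 k R\<close> / 2.\<close>
  define C where "C = 2 / (pi * U2 k R)"
  have C: "C > 0" using bc(5) by (simp add: C_def)
  interpret normalized_profile "\<lambda>s. C * U0 k s" "\<lambda>s. C * U1 k s" "\<lambda>s. C * U2 k s" "\<lambda>s. C * U3 k s" R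
  proof
    show "((\<lambda>s. C * U3 k s) has_real_derivative - 8 * (C * U0 k s)) (at s)" for s
      using DERIV_cmult[OF U3_deriv, of C k s] by (simp add: mult_ac)
    show "0 \<le> C * U0 k s" if "0 \<le> s" "s \<le> R" for s
    proof -
      have "\<beta> * s \<le> \<beta> * R" using that beta_pos by simp
      then show ?thesis using radius_less[of R] R C bc(2) that by (intro mult_nonneg_nonneg U0_nonneg) auto
    qed
    show "pi * (C * U2 k R) / 2 = 1" using bc(5) by (simp add: C_def)
  qed (use bc R C in \<open>auto intro!: DERIV_cmult U0_deriv U1_deriv U2_deriv\<close>)
  have rho3: "rho3 R C = dens"
    unfolding dens_def by (auto simp: fun_eq_iff rho3_def U0_def k_def Let_def split: split_indicator)
  have "(\<integral>x. dens x \<partial>lborel) = enn2real (\<integral>\<^sup>+x. ennreal (dens x) \<partial>lborel)"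
    by (rule integral_eq_nn_integral) (auto simp: dens_nonneg)
  also have "\<dots> = 1" by (simp only: nn_integral_dens normalized) simp
  finally show "\<exists>C::real.
          (\<integral>x. rho3 R C x \<partial>lborel) = 1 \<and>
          (\<forall>x. rho3 R C x \<ge> 0) \<and>
          (\<forall>\<mu>. is_minimizer \<mu> \<longleftrightarrow>
             (\<exists>a. \<mu> = translate a (density lborel (\<lambda>x. ennreal (rho3 R C x)))))"
    using is_minimizer_iff dens_nonneg unfolding \<rho>_def rho3[symmetric] by blast
qed

end
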